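(* For every $\alpha\geqslant\frac{2}{\pi}\big(1+\frac{1}{3\sqrt\pi}\big)$ there exists a non-negative function $\zeta\in L^2$ satisfying $\zeta=\varPhi(\zeta)$ (a.e. on $(0,\pi/2)$). Moreover this $\zeta$ satisfies $$0\leqslant\sigma+\tfrac13(H\zeta)(\sigma)\leqslant\pi\ \text{ for almost all }\sigma\in(0,\pi/2),\qquad \|\zeta\|\leqslant\frac{9\sqrt\pi}{2}.$$
   Context: $L^2$ denotes $L^2(0,\pi/2)$ with norm $\|f\|=\big(\int_0^{\pi/2}|f(\sigma)|^2\,d\sigma\big)^{1/2}$. The kernel is $K(s,\sigma)=\log\Big|\frac{\sin(s+\sigma)}{\sin(s-\sigma)}\Big|$ for $s,\sigma\in(0,\pi/2)$, $s\neq\sigma$, and for $w\in L^2$ the operator $H$ is $(Hw)(\sigma)=\frac1\pi\int_0^{\pi/2}K(s,\sigma)\,w(s)\,ds$, $\sigma\in[0,\pi/2]$. For a parameter $\alpha>0$ (the reduced Froude number) the nonlinear operator $\varPhi$ is defined for $\zeta\in L^2$ by $$\varPhi(\zeta)(\sigma)=\frac{3}{\alpha\pi}\,\frac{\sin\big(\sigma+\frac13(H\zeta)(\sigma)\big)\cot\sigma}{\exp\int_0^\sigma\zeta(s)\,ds},\qquad\sigma\in(0,\pi/2].$$ *)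

theory Defs
  imports "HOL-Analysis.Analysis"
begin

definition I0 :: "real set" where
  "I0 = {0<..<pi/2}"

text \<open>L^2(0,pi/2): Borel-measurable real functions whose square is Lebesgue integrable on (0,pi/2).
  (Values outside (0,pi/2) are irrelevant.)\<close>
definition L2 :: "(real \<Rightarrow> real) set" where
  "L2 = {f. f \<in> borel_measurable lborel \<and> set_integrable lborel I0 (\<lambda>s. (f s)^2)}"

definition L2norm :: "(real \<Rightarrow> real) \<Rightarrow> real" where
  "L2norm f = sqrt (LBINT s:I0. (f s)^2)"

text \<open>The kernel K(s,sigma) = log |sin(s+sigma)/sin(s-sigma)| (the diagonal s = sigma is a null set).\<close>
definition K :: "real \<Rightarrow> real \<Rightarrow> real" where
  "K s \<sigma> = ln \<bar>sin (s + \<sigma>) / sin (s - \<sigma>)\<bar>"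

definition H :: "(real \<Rightarrow> real) \<Rightarrow> real \<Rightarrow> real" where
  "H w \<sigma> = (1 / pi) * (LBINT s:I0. K s \<sigma> * w s)"

definition Phi :: "real \<Rightarrow> (real \<Rightarrow> real) \<Rightarrow> real \<Rightarrow> real" where
  "Phi \<alpha> \<zeta> \<sigma> =
     (3 / (\<alpha> * pi)) * (sin (\<sigma> + (1/3) * H \<zeta> \<sigma>) * cot \<sigma>)
       / exp (LBINT s:{0<..<\<sigma>}. \<zeta> s)"

end

theory Submission
  imports Defs "HOL-Complex_Analysis.Great_Picard"
begin

text \<open>
  Put \<open>c = 3/(\<alpha>\<pi>)\<close> and \<open>\<theta> = \<sigma> + H\<zeta>/3\<close>. The equation \<open>\<zeta> = c sin \<theta> cot \<sigma> exp (-\<integral>\<zeta>)\<close> integrates to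
  \<open>exp \<integral>\<zeta> = 1 + c \<integral> sin \<theta> cot\<close>, so that \<open>\<zeta>\<close> is an explicit functional of \<open>\<theta>\<close> and only \<open>\<theta>\<close> is unknown.
  The operator \<open>H\<close> sends \<open>sin 2m\<sigma>\<close> to \<open>sin 2m\<sigma> / (2m)\<close>, whence \<open>\<parallel>(H\<zeta>)'\<parallel> = \<parallel>\<zeta>\<parallel>\<close> and
  \<open>|H\<zeta>(\<sigma>)| \<le> sqrt (min \<sigma> (\<pi>/2 - \<sigma>)) \<parallel>\<zeta>\<parallel>\<close>. With Hardy's inequality \<open>\<parallel>cot \<sqdot> H\<zeta>\<parallel> \<le> 2 \<parallel>(H\<zeta>)'\<parallel>\<close> this gives
  \<open>\<parallel>\<zeta>\<parallel> \<le> c (1 + 2/3 \<parallel>\<zeta>\<parallel>)\<close>; for the admissible \<open>\<alpha>\<close> this forces \<open>\<parallel>\<zeta>\<parallel> \<le> 9 sqrt \<pi> / 2\<close>, which in turn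
  forces \<open>\<theta> \<le> \<pi>\<close>.

  Existence is obtained from approximate problems in which the sine is truncated to \<open>[0, \<pi>]\<close>, the cotangent
  is cut off near 0, and \<open>H\<close> is replaced by an Abel-weighted finite sine sum. These are finite-dimensional and
  are solved up to a small error by Kuhn's lemma (the combinatorial core of Brouwer's theorem). The a priori
  bound makes the approximate \<open>\<theta>\<close> uniformly Hoelder continuous of exponent 1/2; Arzela-Ascoli yields a
  limit, and the majorant \<open>C / sqrt \<sigma>\<close> of the approximate \<open>\<zeta>\<close> justifies passing to the limit in all integrals.
\<close>

section \<open>Approximate fixed points and integration\<close>

text \<open>Kuhn's lemma on a fine grid yields a cell carrying both labels in every coordinate, so
  \<open>f x i - x i\<close> nearly changes sign inside it; the Lipschitz bound in the maximum norm
  makes this difference small at the corner \<open>q\<close>.\<close>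

lemma approximate_fixed_point_cube:
  fixes f :: "(nat \<Rightarrow> real) \<Rightarrow> nat \<Rightarrow> real"
  assumes "M > 0" "L \<ge> 0" "e > 0"
    and bound: "\<And>x i. (\<forall>j<n. \<bar>x j\<bar> \<le> M) \<Longrightarrow> i < n \<Longrightarrow> \<bar>f x i\<bar> \<le> M"
    and lip: "\<And>x y d i. (\<forall>j<n. \<bar>x j\<bar> \<le> M) \<Longrightarrow> (\<forall>j<n. \<bar>y j\<bar> \<le> M) \<Longrightarrow>
        (\<forall>j<n. \<bar>x j - y j\<bar> \<le> d) \<Longrightarrow> i < n \<Longrightarrow> \<bar>f x i - f y i\<bar> \<le> L * d"
  obtains x where "\<forall>j<n. \<bar>x j\<bar> \<le> M" "\<forall>i<n. \<bar>f x i - x i\<bar> \<le> e"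
proof -
  \<comment> \<open>\<open>p\<close> is the number of grid steps per edge, so large that the mesh
    \<open>h = 2 * M / p\<close> satisfies \<open>(1 + L) * h \<le> e\<close>.\<close>
  obtain p :: nat where p: "2 * M * (1 + L) / e < real p"
    using reals_Archimedean2 by blast
  have "0 < 2 * M * (1 + L) / e"
    using assms(1-3) by simp
  with p have "real p > 0"
    by linarith
  then have p0: "0 < p"
    by simp
  define h where "h = 2 * M / real p"
  have h0: "h > 0"
    using \<open>M > 0\<close> p0 by (simp add: h_def)
  have hp: "h * real p = 2 * M"
    using p0 by (simp add: h_def)
  have he: "(1 + L) * h \<le> e"
    using p p0 assms(1-3) by (simp add: h_def field_simps)
  define pt where "pt z i = h * real (z i) - M" for z :: "nat \<Rightarrow> nat" and i :: nat
  \<comment> \<open>Label 1 means that \<open>f\<close> does not increase coordinate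
    \<open>i\<close>, label 0 that it does not decrease it. Kuhn's lemma prescribes 0 on the face
    \<open>z i = 0\<close> and 1 on \<open>z i = p\<close>; both readings stay true there because
    \<open>f\<close> maps the cube into itself.\<close>
  define label :: "(nat \<Rightarrow> nat) \<Rightarrow> nat \<Rightarrow> nat"
    where "label z i = (if z i = p \<or> (z i \<noteq> 0 \<and> f (pt z) i < pt z i) then 1 else 0)" for z i
  have pt_bound: "\<bar>pt z i\<bar> \<le> M" if "z i \<le> p" for z i
  proof -
    have "h * real (z i) \<le> h * real p"
      using that h0 by (intro mult_left_mono) auto
    moreover have "0 \<le> h * real (z i)"
      using h0 by simp
    ultimately show ?thesis
      by (auto simp: pt_def hp abs_le_iff)
  qed
  have lab1: "f (pt z) i \<le> pt z i" if "label z i = 1" "\<forall>j<n. z j \<le> p" "i < n" for z i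
  proof (cases "z i = p")
    case True
    then have "pt z i = M"
      by (simp add: pt_def hp)
    then show ?thesis
      using bound[of "pt z" i] that pt_bound by (auto simp: abs_le_iff)
  qed (use that in \<open>auto simp: label_def split: if_splits\<close>)
  have lab0: "pt z i \<le> f (pt z) i" if "label z i = 0" "\<forall>j<n. z j \<le> p" "i < n" for z i
  proof (cases "z i = 0")
    case True
    then have "pt z i = - M"
      by (simp add: pt_def)
    then show ?thesis
      using bound[of "pt z" i] that pt_bound[of z] by (force simp: abs_le_iff)
  qed (use that in \<open>auto simp: label_def split: if_splits\<close>)
  obtain q where q: "\<forall>i<n. q i < p"
    and qrs: "\<forall>i<n. \<exists>r s. (\<forall>j<n. q j \<le> r j \<and> r j \<le> q j + 1) \<and>
                (\<forall>j<n. q j \<le> s j \<and> s j \<le> q j + 1) \<and> label r i \<noteq> label s i"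
    by (rule kuhn_lemma[OF p0, of n label]) (use p0 in \<open>auto simp: label_def\<close>)
  have near: "s i \<le> p" "\<bar>pt q i - pt s i\<bar> \<le> h" "\<bar>f (pt q) i - f (pt s) i\<bar> \<le> L * h"
    if s: "\<forall>j<n. q j \<le> s j \<and> s j \<le> q j + 1" and "i < n" for s i
  proof -
    have sp: "s j \<le> p" if "j < n" for j
      using s q that by (metis Suc_eq_plus1 Suc_leI le_trans)
    have d: "\<bar>pt q j - pt s j\<bar> \<le> h" if "j < n" for j
    proof -
      have "s j = q j \<or> s j = q j + 1"
        using s that by force
      then show ?thesis
        using h0 by (auto simp: pt_def algebra_simps)
    qed
    show "s i \<le> p" "\<bar>pt q i - pt s i\<bar> \<le> h"
      using sp d \<open>i < n\<close> by auto
    show "\<bar>f (pt q) i - f (pt s) i\<bar> \<le> L * h"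
      using q sp d \<open>i < n\<close> by (intro lip allI impI pt_bound) (auto intro: less_imp_le)
  qed
  show thesis
  proof (rule that)
    show "\<forall>j<n. \<bar>pt q j\<bar> \<le> M"
      using q pt_bound by (auto intro: less_imp_le)
    show "\<forall>i<n. \<bar>f (pt q) i - pt q i\<bar> \<le> e"
    proof (intro allI impI)
      fix i assume "i < n"
      then obtain r s where rs: "\<forall>j<n. q j \<le> r j \<and> r j \<le> q j + 1" "\<forall>j<n. q j \<le> s j \<and> s j \<le> q j + 1"
        "label r i \<noteq> label s i"
        using qrs by blast
      \<comment> \<open>From a corner of known sign to \<open>q\<close>, the value of
        \<open>f\<close> moves by at most \<open>L * h\<close> and the coordinate by at most
        \<open>h\<close>. The two corners \<open>r\<close> and \<open>s\<close> supply one sign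
        each.\<close>
      have "f (pt q) i - pt q i \<le> (1 + L) * h"
        if "label s i = 1" "\<forall>j<n. q j \<le> s j \<and> s j \<le> q j + 1" for s
        using near[OF that(2) \<open>i < n\<close>] lab1[OF that(1) _ \<open>i < n\<close>] near(1)[OF that(2)]
        by (auto simp: algebra_simps abs_le_iff)
      moreover have "pt q i - f (pt q) i \<le> (1 + L) * h"
        if "label s i = 0" "\<forall>j<n. q j \<le> s j \<and> s j \<le> q j + 1" for s
        using near[OF that(2) \<open>i < n\<close>] lab0[OF that(1) _ \<open>i < n\<close>] near(1)[OF that(2)]
        by (auto simp: algebra_simps abs_le_iff)
      moreover have "label r i = 0 \<and> label s i = 1 \<or> label r i = 1 \<and> label s i = 0"
        using rs(3) by (auto simp: label_def split: if_splits)
      ultimately show "\<bar>f (pt q) i - pt q i\<bar> \<le> e"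
        using rs he by (smt (verit))
    qed
  qed
qed

text \<open>The integral of \<open>(f - t * g)^2\<close> is a quadratic in \<open>t\<close> that is
  never negative; evaluate it at its minimiser \<open>t = b / d\<close>.\<close>

lemma Cauchy_Schwarz_set_integral:
  fixes f g :: "real \<Rightarrow> real"
  assumes f: "set_integrable M A (\<lambda>x. (f x)\<^sup>2)" and g: "set_integrable M A (\<lambda>x. (g x)\<^sup>2)"
    and fg: "set_integrable M A (\<lambda>x. f x * g x)"
  shows "\<bar>LINT x:A|M. f x * g x\<bar> \<le> sqrt (LINT x:A|M. (f x)\<^sup>2) * sqrt (LINT x:A|M. (g x)\<^sup>2)"
proof -
  define a b d where "a = (LINT x:A|M. (f x)\<^sup>2)" and "b = (LINT x:A|M. f x * g x)"
    and "d = (LINT x:A|M. (g x)\<^sup>2)"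
  have nonneg: "a \<ge> 0" "d \<ge> 0"
    unfolding a_def d_def set_lebesgue_integral_def by (auto intro!: integral_nonneg_AE)
  have quad: "0 \<le> a - 2 * t * b + t\<^sup>2 * d" for t
  proof -
    have "0 \<le> (LINT x:A|M. (f x - t * g x)\<^sup>2)"
      unfolding set_lebesgue_integral_def by (auto intro!: integral_nonneg_AE)
    also have "\<dots> = (LINT x:A|M. ((f x)\<^sup>2 - 2 * t * (f x * g x)) + t\<^sup>2 * (g x)\<^sup>2)"
      by (simp add: power2_eq_square algebra_simps)
    also have "\<dots> = a - 2 * t * b + t\<^sup>2 * d"
      using f g fg by (simp add: a_def b_def d_def set_integral_add set_integral_diff)
    finally show ?thesis .
  qed
  have "b\<^sup>2 \<le> a * d"
  proof (cases "d = 0")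
    \<comment> \<open>For \<open>d = 0\<close> the quadratic is affine in \<open>t\<close>, and
      \<open>b \<noteq> 0\<close> would let it take the value -1.\<close>
    case True
    have "b = 0"
    proof (rule ccontr)
      assume "b \<noteq> 0"
      then show False
        using quad[of "(a + 1) / (2 * b)"] True by simp
    qed
    then show ?thesis
      using nonneg by simp
  next
    case False
    then have "d > 0"
      using nonneg by simp
    then show ?thesis
      using quad[of "b / d"] by (simp add: field_simps power2_eq_square)
  qed
  then have "\<bar>b\<bar> \<le> sqrt (a * d)"
    by (metis real_sqrt_abs real_sqrt_le_iff)
  then show ?thesis
    by (simp add: a_def b_def d_def real_sqrt_mult)
qed

section \<open>Integrability and the fundamental theorem on bounded sets\<close>

lemma set_integrable_bounded_lborel:
  fixes f :: "real \<Rightarrow> real"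
  assumes "f \<in> borel_measurable borel" "A \<in> sets borel" "bounded A"
    and "\<And>x. x \<in> A \<Longrightarrow> \<bar>f x\<bar> \<le> B"
  shows "set_integrable lborel A f"
proof (rule set_integrable_bound)
  have "emeasure lborel A < \<infinity>"
    using \<open>bounded A\<close> by (rule emeasure_bounded_finite)
  then show "set_integrable lborel A (\<lambda>_. B)"
    using assms(2) by (simp add: set_integrable_def)
qed (use assms in \<open>auto simp: set_borel_measurable_def intro!: AE_I2 order_trans[OF _ abs_ge_self]\<close>)

lemma set_integral_FTC_open:
  fixes f F :: "real \<Rightarrow> real"
  assumes "a \<le> b" and "\<And>x. a \<le> x \<Longrightarrow> x \<le> b \<Longrightarrow> (F has_real_derivative f x) (at x)"
    and "\<And>x. a \<le> x \<Longrightarrow> x \<le> b \<Longrightarrow> isCont f x"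
  shows "set_integrable lborel {a<..<b} f" "(LBINT x:{a<..<b}. f x) = F b - F a"
proof -
  have "has_bochner_integral lborel (\<lambda>x. f x * indicator {a..b} x) (F b - F a)"
    using assms by (intro has_bochner_integral_FTC_Icc_real) auto
  then have *: "set_integrable lborel {a..b} f" "(LBINT x:{a..b}. f x) = F b - F a"
    by (auto simp: has_bochner_integral_iff set_integrable_def set_lebesgue_integral_def mult.commute)
  show "set_integrable lborel {a<..<b} f"
    by (rule set_integrable_subset[OF *(1)]) auto
  show "(LBINT x:{a<..<b}. f x) = F b - F a"
    unfolding *(2)[symmetric]
    by (rule set_integral_discrete_difference[where X="{a, b}"]) auto
qed

section \<open>Sine and cosine sums\<close>

text \<open>This is the image under \<open>H\<close> of the sine sum with coefficients \<beta>, as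
  \<open>H\<close> divides each mode by its frequency. Indices start at 0, so the frequency of index
  \<open>m\<close> is \<open>2 * (m + 1)\<close>.\<close>

definition sin_poly :: "nat \<Rightarrow> (nat \<Rightarrow> real) \<Rightarrow> real \<Rightarrow> real" where
  "sin_poly N \<beta> x = (\<Sum>m<N. \<beta> m / (2 * (real m + 1)) * sin (2 * (real m + 1) * x))"

definition cos_poly :: "nat \<Rightarrow> (nat \<Rightarrow> real) \<Rightarrow> real \<Rightarrow> real" where
  "cos_poly N \<beta> x = (\<Sum>m<N. \<beta> m * cos (2 * (real m + 1) * x))"

lemma I0_measurable [simp, measurable]: "I0 \<in> sets borel"
  by (simp add: I0_def)

lemma bounded_I0 [simp]: "bounded I0"
  by (simp add: I0_def bounded_box flip: box_real)

lemma isCont_set_integrable: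
  fixes f :: "real \<Rightarrow> real"
  assumes "\<And>x. isCont f x" "A \<in> sets borel" "bounded A"
  shows "set_integrable lborel A f"
proof -
  have "compact (f ` closure A)"
    using assms by (intro compact_continuous_image continuous_at_imp_continuous_on) auto
  then obtain B where "\<forall>y\<in>f ` closure A. norm y \<le> B"
    using compact_imp_bounded bounded_iff by blast
  then have "\<bar>f x\<bar> \<le> B" if "x \<in> A" for x
    using that closure_subset[of A] by auto
  moreover have "f \<in> borel_measurable borel"
    using assms by (intro borel_measurable_continuous_onI continuous_at_imp_continuous_on) auto
  ultimately show ?thesis
    using assms by (intro set_integrable_bounded_lborel) auto
qed

lemma set_integral_mono_subset:
  fixes f :: "'a \<Rightarrow> real"
  assumes "set_integrable M B f" "A \<in> sets M" "A \<subseteq> B" "\<And>x. x \<in> B \<Longrightarrow> 0 \<le> f x"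
  shows "(LINT x:A|M. f x) \<le> (LINT x:B|M. f x)"
  unfolding set_lebesgue_integral_def
proof (rule integral_mono)
  show "integrable M (\<lambda>x. indicator A x *\<^sub>R f x)" "integrable M (\<lambda>x. indicator B x *\<^sub>R f x)"
    using set_integrable_subset[OF assms(1-3)] assms(1) by (auto simp: set_integrable_def)
qed (use assms in \<open>auto simp: indicator_def\<close>)

section \<open>Orthogonality and Bessel's inequality\<close>

lemma integral_cos_even:
  "(LBINT s:I0. cos (2 * of_int j * s)) = (if j = 0 then pi / 2 else 0)"
proof (cases "j = 0")
  case True
  have "(LBINT s:{0<..<pi/2}. (1::real)) = pi/2 - 0"
    by (rule set_integral_FTC_open(2)[where F="\<lambda>x. x"]) auto
  then show ?thesis
    using True by (simp add: I0_def)
next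
  case False
  have "(LBINT s:{0<..<pi/2}. cos (2 * of_int j * s)) =
    sin (2 * of_int j * (pi/2)) / (2 * of_int j) - sin (2 * of_int j * 0) / (2 * of_int j)"
    by (rule set_integral_FTC_open(2)[where F="\<lambda>x. sin (2 * of_int j * x) / (2 * of_int j)"])
      (use False in \<open>auto intro!: derivative_eq_intros\<close>)
  moreover have "sin (2 * of_int j * (pi/2)) = 0"
    by (metis mult.commute nonzero_mult_div_cancel_left sin_integer_2pi times_divide_eq_right
        mult.left_commute mult.assoc sin_npi_int zero_neq_numeral)
  ultimately show ?thesis
    using False by (simp add: I0_def)
qed

text \<open>The product-to-sum formula leaves the frequencies \<open>m - n\<close> and
  \<open>m + n + 2\<close>, of which only the first can vanish; it may be negative, hence the
  integer index in \<open>integral_cos_even\<close>.\<close>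

lemma orthogonal_cos:
  "(LBINT s:I0. cos (2 * (real m + 1) * s) * cos (2 * (real n + 1) * s)) = (if m = n then pi / 4 else 0)"
proof -
  have "(LBINT s:I0. cos (2 * (real m + 1) * s) * cos (2 * (real n + 1) * s)) =
     (LBINT s:I0. (1/2) * cos (2 * of_int (int m - int n) * s) + (1/2) * cos (2 * of_int (int m + int n + 2) * s))"
    by (simp add: cos_times_cos algebra_simps add_divide_distrib)
  also have "\<dots> = (1/2) * (LBINT s:I0. cos (2 * of_int (int m - int n) * s)) +
      (1/2) * (LBINT s:I0. cos (2 * of_int (int m + int n + 2) * s))"
    by (subst set_integral_add) (auto intro!: isCont_set_integrable)
  finally show ?thesis
    unfolding integral_cos_even by auto
qed

lemma orthogonal_sin:
  "(LBINT s:I0. sin (2 * (real m + 1) * s) * sin (2 * (real n + 1) * s)) = (if m = n then pi / 4 else 0)"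
proof -
  have "(LBINT s:I0. sin (2 * (real m + 1) * s) * sin (2 * (real n + 1) * s)) =
     (LBINT s:I0. (1/2) * cos (2 * of_int (int m - int n) * s) - (1/2) * cos (2 * of_int (int m + int n + 2) * s))"
    by (simp add: sin_times_sin algebra_simps diff_divide_distrib)
  also have "\<dots> = (1/2) * (LBINT s:I0. cos (2 * of_int (int m - int n) * s)) -
      (1/2) * (LBINT s:I0. cos (2 * of_int (int m + int n + 2) * s))"
    by (subst set_integral_diff) (auto intro!: isCont_set_integrable)
  finally show ?thesis
    unfolding integral_cos_even by auto
qed

lemma set_integral_sum:
  fixes f :: "'i \<Rightarrow> 'a \<Rightarrow> real"
  assumes "\<And>i. i \<in> J \<Longrightarrow> set_integrable M A (f i)"
  shows "(LINT x:A|M. (\<Sum>i\<in>J. f i x)) = (\<Sum>i\<in>J. LINT x:A|M. f i x)"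
  using assms unfolding set_lebesgue_integral_def set_integrable_def
  by (simp add: sum_distrib_left Bochner_Integration.integral_sum)

lemma isCont_cos_poly [simp]: "isCont (cos_poly N \<beta>) x"
  unfolding cos_poly_def by (intro continuous_intros)

lemma isCont_sin_poly [simp]: "isCont (sin_poly N \<beta>) x"
  unfolding sin_poly_def by (intro continuous_intros) auto

lemma sin_poly_has_derivative [derivative_intros]:
  "(sin_poly N \<beta> has_real_derivative cos_poly N \<beta> x) (at x)"
  unfolding sin_poly_def cos_poly_def
  by (rule derivative_eq_intros refl sum.cong | simp)+

lemma norm_cos_poly: "(LBINT s:I0. (cos_poly N \<beta> s)\<^sup>2) = pi / 4 * (\<Sum>m<N. (\<beta> m)\<^sup>2)"
proof -
  have "(LBINT s:I0. (cos_poly N \<beta> s)\<^sup>2) = (LBINT s:I0. \<Sum>m<N. \<Sum>n<N.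
     (\<beta> m * \<beta> n) * (cos (2 * (real m + 1) * s) * cos (2 * (real n + 1) * s)))"
    by (simp add: cos_poly_def power2_eq_square sum_product mult_ac)
  also have "\<dots> = (\<Sum>m<N. \<Sum>n<N. (\<beta> m * \<beta> n) * (if m = n then pi / 4 else 0))"
    by (subst set_integral_sum set_integral_mult_right orthogonal_cos
      | intro isCont_set_integrable isCont_sum ballI sum.cong continuous_intros | simp)+
  also have "\<dots> = pi / 4 * (\<Sum>m<N. (\<beta> m)\<^sup>2)"
    by (simp add: if_distrib[of "\<lambda>x. _ * x"] sum.delta sum_distrib_left power2_eq_square mult_ac cong: if_cong)
  finally show ?thesis .
qed

text \<open>In the integral of \<open>(f - p)^2\<close>, with \<open>p\<close> the sine sum with the
  coefficients of \<open>f\<close>, the cross integral equals the integral of \<open>p^2\<close>.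
  Combined with \<open>norm_cos_poly\<close> this is the finite form of the bound of
  \<open>(H f)'\<close> by \<open>f\<close> in norm.\<close>

lemma Bessel_sin:
  fixes f :: "real \<Rightarrow> real"
  assumes f: "f \<in> borel_measurable borel" "\<And>s. s \<in> I0 \<Longrightarrow> \<bar>f s\<bar> \<le> B"
    and b: "\<And>m. b m = 4 / pi * (LBINT s:I0. f s * sin (2 * (real m + 1) * s))"
  shows "pi / 4 * (\<Sum>m<N. (b m)\<^sup>2) \<le> (LBINT s:I0. (f s)\<^sup>2)"
proof -
  define p where "p s = (\<Sum>m<N. b m * sin (2 * (real m + 1) * s))" for s
  have p: "isCont p x" for x
    unfolding p_def by (intro continuous_intros)
  have [measurable]: "p \<in> borel_measurable borel" "f \<in> borel_measurable borel"
    using p f by (auto intro!: borel_measurable_continuous_onI continuous_at_imp_continuous_on)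
  have fB: "\<bar>f s * g s\<bar> \<le> B * C" if "s \<in> I0" "\<bar>g s\<bar> \<le> C" for s C and g :: "real \<Rightarrow> real"
    using f(2)[OF that(1)] that(2) by (auto simp: abs_mult intro!: mult_mono)
  have f2: "set_integrable lborel I0 (\<lambda>s. (f s)\<^sup>2)"
    by (rule set_integrable_bounded_lborel[where B="B\<^sup>2"])
      (use power_mono[OF f(2), of _ 2] in auto)
  have fs: "set_integrable lborel I0 (\<lambda>s. f s * sin (2 * (real m + 1) * s))" for m
    by (rule set_integrable_bounded_lborel[where B="B * 1"])
      (use fB[of _ "\<lambda>s. sin (2 * (real m + 1) * s)" 1] in auto)
  have fp: "(LBINT s:I0. f s * p s) = pi / 4 * (\<Sum>m<N. (b m)\<^sup>2)"
    and fp': "set_integrable lborel I0 (\<lambda>s. f s * p s)"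
  proof -
    have *: "f s * p s = (\<Sum>m<N. b m * (f s * sin (2 * (real m + 1) * s)))" for s
      by (simp add: p_def sum_distrib_left mult_ac)
    have "(LBINT s:I0. f s * p s) = (\<Sum>m<N. b m * (LBINT s:I0. f s * sin (2 * (real m + 1) * s)))"
      unfolding * using fs by (subst set_integral_sum) auto
    also have "\<dots> = (\<Sum>m<N. b m * (pi / 4 * b m))"
      by (simp add: b)
    finally show "(LBINT s:I0. f s * p s) = pi / 4 * (\<Sum>m<N. (b m)\<^sup>2)"
      by (simp add: sum_distrib_left power2_eq_square mult_ac)
    show "set_integrable lborel I0 (\<lambda>s. f s * p s)"
      unfolding * set_integrable_def scaleR_sum_right
      by (intro Bochner_Integration.integrable_sum)
        (use set_integrable_mult_right[OF fs] in \<open>auto simp: set_integrable_def\<close>)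
  qed
  have pp: "(LBINT s:I0. (p s)\<^sup>2) = pi / 4 * (\<Sum>m<N. (b m)\<^sup>2)"
  proof -
    have "(LBINT s:I0. (p s)\<^sup>2) = (LBINT s:I0. \<Sum>m<N. \<Sum>n<N.
       (b m * b n) * (sin (2 * (real m + 1) * s) * sin (2 * (real n + 1) * s)))"
      by (simp add: p_def power2_eq_square sum_product mult_ac)
    also have "\<dots> = (\<Sum>m<N. \<Sum>n<N. (b m * b n) * (if m = n then pi / 4 else 0))"
      by (subst set_integral_sum set_integral_mult_right orthogonal_sin
        | intro isCont_set_integrable isCont_sum ballI sum.cong continuous_intros | simp)+
    also have "\<dots> = pi / 4 * (\<Sum>m<N. (b m)\<^sup>2)"
      by (simp add: if_distrib[of "\<lambda>x. _ * x"] sum.delta sum_distrib_left power2_eq_square mult_ac cong: if_cong)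
    finally show ?thesis .
  qed
  have p2: "set_integrable lborel I0 (\<lambda>s. (p s)\<^sup>2)"
    using p by (intro isCont_set_integrable continuous_intros) auto
  have "0 \<le> (LBINT s:I0. (f s - p s)\<^sup>2)"
    unfolding set_lebesgue_integral_def by (auto intro!: integral_nonneg_AE)
  also have "\<dots> = (LBINT s:I0. ((f s)\<^sup>2 - 2 * (f s * p s)) + (p s)\<^sup>2)"
    by (simp add: power2_eq_square algebra_simps)
  also have "\<dots> = (LBINT s:I0. (f s)\<^sup>2) - 2 * (LBINT s:I0. f s * p s) + (LBINT s:I0. (p s)\<^sup>2)"
    using f2 fp' p2 by (simp add: set_integral_add set_integral_diff)
  finally show ?thesis
    unfolding fp pp by simp
qed

section \<open>Hoelder bounds and Hardy's inequality\<close>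

lemma sin_poly_0 [simp]: "sin_poly N \<beta> 0 = 0"
  by (simp add: sin_poly_def)

lemma sin_poly_pi_half [simp]: "sin_poly N \<beta> (pi / 2) = 0"
proof -
  have "sin (2 * (real m + 1) * (pi / 2)) = 0" for m
    using sin_npi[of "Suc m"] by (simp add: algebra_simps)
  then show ?thesis
    by (simp add: sin_poly_def)
qed

text \<open>Cauchy-Schwarz for the derivative against the constant 1. Taking an endpoint 0 or pi/2,
  where \<open>sin_poly\<close> vanishes, gives the bounds by \<open>sqrt x\<close> and
  \<open>sqrt (pi/2 - x)\<close>.\<close>

lemma sin_poly_Hoelder_aux:
  assumes "0 \<le> x" "x \<le> y" "y \<le> pi / 2"
  shows "\<bar>sin_poly N \<beta> y - sin_poly N \<beta> x\<bar> \<le> sqrt (y - x) * sqrt (LBINT s:I0. (cos_poly N \<beta> s)\<^sup>2)"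
proof -
  have "(LBINT s:{x<..<y}. cos_poly N \<beta> s) = sin_poly N \<beta> y - sin_poly N \<beta> x"
    using assms by (intro set_integral_FTC_open(2) sin_poly_has_derivative) auto
  moreover have "(LBINT s:{x<..<y}. (1::real)) = y - x"
    using assms by (intro set_integral_FTC_open(2)) auto
  moreover have "\<bar>LBINT s:{x<..<y}. 1 * cos_poly N \<beta> s\<bar> \<le>
      sqrt (LBINT s:{x<..<y}. 1\<^sup>2) * sqrt (LBINT s:{x<..<y}. (cos_poly N \<beta> s)\<^sup>2)"
    by (intro Cauchy_Schwarz_set_integral isCont_set_integrable continuous_intros)
      (auto simp: bounded_box simp flip: box_real)
  ultimately have "\<bar>sin_poly N \<beta> y - sin_poly N \<beta> x\<bar> \<le>
      sqrt (y - x) * sqrt (LBINT s:{x<..<y}. (cos_poly N \<beta> s)\<^sup>2)"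
    by simp
  also have "\<dots> \<le> sqrt (y - x) * sqrt (LBINT s:I0. (cos_poly N \<beta> s)\<^sup>2)"
    by (intro mult_left_mono real_sqrt_le_mono set_integral_mono_subset isCont_set_integrable continuous_intros)
      (use assms in \<open>auto simp: I0_def\<close>)
  finally show ?thesis .
qed

lemma sin_poly_Hoelder:
  assumes "x \<in> {0..pi/2}" "y \<in> {0..pi/2}"
  shows "\<bar>sin_poly N \<beta> y - sin_poly N \<beta> x\<bar> \<le> sqrt \<bar>y - x\<bar> * sqrt (LBINT s:I0. (cos_poly N \<beta> s)\<^sup>2)"
  using sin_poly_Hoelder_aux[of x y N \<beta>] sin_poly_Hoelder_aux[of y x N \<beta>] assms
  by (cases "x \<le> y") (auto simp: abs_minus_commute)

text \<open>The constant is not uniform over the approximations; it only provides boundedness of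
  \<open>sin_poly * cot\<close> and the vanishing of a boundary term at 0.\<close>

lemma sin_poly_linear_bound: "\<bar>sin_poly N \<beta> x\<bar> \<le> (\<Sum>m<N. \<bar>\<beta> m\<bar>) * \<bar>x\<bar>"
  unfolding sin_poly_def sum_distrib_right
proof (rule order_trans[OF sum_abs sum_mono])
  fix m
  define k where "k = 2 * (real m + 1)"
  have "k > 0"
    by (simp add: k_def)
  have "\<bar>\<beta> m / k\<bar> * \<bar>sin (k * x)\<bar> \<le> \<bar>\<beta> m / k\<bar> * \<bar>k * x\<bar>"
    by (intro mult_left_mono abs_sin_x_le_abs_x) auto
  also have "\<dots> = \<bar>\<beta> m\<bar> * \<bar>x\<bar>"
    using \<open>k > 0\<close> by (simp add: abs_mult)
  finally show "\<bar>\<beta> m / (2 * (real m + 1)) * sin (2 * (real m + 1) * x)\<bar> \<le> \<bar>\<beta> m\<bar> * \<bar>x\<bar>"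
    by (simp add: abs_mult k_def)
qed

lemma cot_nonneg_pi_half: "0 \<le> cot x" if "0 < x" "x \<le> pi / 2" for x :: real
  using that by (auto simp: cot_def intro!: divide_nonneg_nonneg cos_ge_zero sin_ge_zero)

text \<open>\<open>sin t - t * cos t\<close> vanishes at 0 and has the non-negative derivative
  \<open>t * sin t\<close>.\<close>

lemma cot_le_inverse: "cot x \<le> 1 / x" if "0 < x" "x \<le> pi / 2" for x :: real
proof -
  have "sin 0 - 0 * cos 0 \<le> sin x - x * cos x"
  proof (rule DERIV_nonneg_imp_nondecreasing[of 0 x "\<lambda>x. sin x - x * cos x"])
    fix t assume t: "0 \<le> t" "t \<le> x"
    have "((\<lambda>x. sin x - x * cos x) has_real_derivative t * sin t) (at t)"
      by (auto intro!: derivative_eq_intros)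
    moreover have "0 \<le> t * sin t"
      using t that by (intro mult_nonneg_nonneg sin_ge_zero) auto
    ultimately show "\<exists>y. ((\<lambda>x. sin x - x * cos x) has_real_derivative y) (at t) \<and> 0 \<le> y"
      by blast
  qed (use that in auto)
  moreover have "sin x > 0"
    using that by (intro sin_gt_zero) auto
  ultimately show ?thesis
    using that by (simp add: cot_def field_simps)
qed

lemma cot_measurable [measurable]: "(cot :: real \<Rightarrow> real) \<in> borel_measurable borel"
  unfolding cot_def by measurable

lemma sin_poly_measurable [measurable]: "sin_poly N \<beta> \<in> borel_measurable borel"
  unfolding sin_poly_def by measurable

text \<open>Integrating \<open>(u\<^sup>2 cot)' = 2 u u' cot - u\<^sup>2 - u\<^sup>2 cot\<^sup>2\<close> and completing the square.\<close>
lemma Hardy_sin_poly: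
  assumes "0 < \<delta>" "\<delta> < pi / 2"
  shows "(LBINT s:{\<delta><..<pi/2}. (sin_poly N \<beta> s * cot s)\<^sup>2) \<le> 4 * (LBINT s:I0. (cos_poly N \<beta> s)\<^sup>2)"
proof -
  define C where "C = (\<Sum>m<N. \<bar>\<beta> m\<bar>)"
  have C0: "C \<ge> 0"
    by (auto simp: C_def intro: sum_nonneg)
  let ?u = "sin_poly N \<beta>" and ?v = "cos_poly N \<beta>"
  define W' where "W' x = 2 * ?u x * ?v x * cot x - (?u x)\<^sup>2 - (?u x * cot x)\<^sup>2" for x
  have ucot: "\<bar>?u x * cot x\<bar> \<le> C" if "0 < x" "x \<le> pi / 2" for x
  proof -
    have "\<bar>?u x * cot x\<bar> \<le> (C * x) * (1 / x)"
      unfolding abs_mult using that sin_poly_linear_bound[of N \<beta> x] cot_le_inverse[OF that]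
        cot_nonneg_pi_half[OF that] C0
      by (intro mult_mono) (auto simp: C_def)
    then show ?thesis
      using that by simp
  qed
  have int_ucot: "set_integrable lborel {\<eta><..<pi/2} (\<lambda>s. (?u s * cot s)\<^sup>2)" if "0 < \<eta>" for \<eta>
    by (rule set_integrable_bounded_lborel[where B="C\<^sup>2"])
      (use that ucot C0 in \<open>auto simp: bounded_box power_mult_distrib[symmetric] abs_le_square_iff[symmetric] simp flip: box_real\<close>)
  \<comment> \<open>The lower limit is moved down to \<eta> so that the boundary term, at most
    \<open>C^2 * \<eta>\<close>, can be made arbitrarily small. The boundary term at pi/2 is
    zero.\<close>
  have "(LBINT s:{\<delta><..<pi/2}. (?u s * cot s)\<^sup>2) \<le> 4 * (LBINT s:I0. (?v s)\<^sup>2) + 2 * C\<^sup>2 * \<eta>"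
    if \<eta>: "0 < \<eta>" "\<eta> < \<delta>" for \<eta>
  proof -
    have sin_nz: "sin x \<noteq> 0" if "\<eta> \<le> x" "x \<le> pi / 2" for x
      using that \<eta> sin_gt_zero[of x] by auto
    have FTC: "set_integrable lborel {\<eta><..<pi/2} W'"
      "(LBINT s:{\<eta><..<pi/2}. W' s) = (?u (pi/2))\<^sup>2 * cot (pi/2) - (?u \<eta>)\<^sup>2 * cot \<eta>"
    proof (atomize(full), intro conjI set_integral_FTC_open)
      show "((\<lambda>x. (?u x)\<^sup>2 * cot x) has_real_derivative W' x) (at x)" if "\<eta> \<le> x" "x \<le> pi / 2" for x
      proof -
        have "inverse ((sin x)\<^sup>2) = 1 + (cot x)\<^sup>2"
          using sin_nz[OF that] sin_cos_squared_add[of x] by (simp add: cot_def field_simps)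
        then show ?thesis
          using sin_nz[OF that]
          by (auto intro!: derivative_eq_intros DERIV_cot simp: W'_def algebra_simps power2_eq_square)
      qed
      then show "((\<lambda>x. (?u x)\<^sup>2 * cot x) has_real_derivative W' x) (at x)" if "\<eta> \<le> x" "x \<le> pi / 2" for x
        using that .
      show "isCont W' x" if "\<eta> \<le> x" "x \<le> pi / 2" for x
        unfolding W'_def using sin_nz[OF that] by (intro continuous_intros isCont_cot) auto
      then show "isCont W' x" if "\<eta> \<le> x" "x \<le> pi / 2" for x
        using that .
    qed (use \<eta> assms in auto)
    have v2: "set_integrable lborel {\<eta><..<pi/2} (\<lambda>s. (?v s)\<^sup>2)"
      by (intro isCont_set_integrable continuous_intros) (auto simp: bounded_box simp flip: box_real)
    have "(LBINT s:{\<delta><..<pi/2}. (?u s * cot s)\<^sup>2) \<le> (LBINT s:{\<eta><..<pi/2}. (?u s * cot s)\<^sup>2)"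
      using \<eta> int_ucot[of \<eta>] by (intro set_integral_mono_subset) auto
    also have "\<dots> \<le> (LBINT s:{\<eta><..<pi/2}. 4 * (?v s)\<^sup>2 - 2 * W' s)"
    proof (rule set_integral_mono)
      fix s
      have "0 \<le> (2 * ?v s - ?u s * cot s)\<^sup>2 + 2 * (?u s)\<^sup>2"
        by simp
      then show "(?u s * cot s)\<^sup>2 \<le> 4 * (?v s)\<^sup>2 - 2 * W' s"
        by (simp add: W'_def power2_eq_square algebra_simps)
    qed (use int_ucot \<eta> v2 FTC(1) in auto)
    also have "\<dots> = 4 * (LBINT s:{\<eta><..<pi/2}. (?v s)\<^sup>2) + 2 * ((?u \<eta>)\<^sup>2 * cot \<eta>)"
      using v2 FTC by (simp add: set_integral_diff)
    also have "(LBINT s:{\<eta><..<pi/2}. (?v s)\<^sup>2) \<le> (LBINT s:I0. (?v s)\<^sup>2)"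
      by (intro set_integral_mono_subset isCont_set_integrable continuous_intros)
        (use \<eta> in \<open>auto simp: I0_def\<close>)
    also have "(?u \<eta>)\<^sup>2 * cot \<eta> \<le> (C * \<eta>)\<^sup>2 * (1 / \<eta>)"
      using \<eta> assms sin_poly_linear_bound[of N \<beta> \<eta>] cot_le_inverse[of \<eta>] cot_nonneg_pi_half[of \<eta>] C0
      by (intro mult_mono) (auto simp: C_def abs_le_square_iff[symmetric])
    also have "(C * \<eta>)\<^sup>2 * (1 / \<eta>) = C\<^sup>2 * \<eta>"
      using \<eta> by (simp add: power2_eq_square)
    finally show ?thesis
      by (simp add: mult_ac)
  qed
  note * = this
  show ?thesis
  proof (rule field_le_epsilon)
    fix e :: real assume "e > 0"
    define \<eta> where "\<eta> = min (\<delta> / 2) (e / (2 * C\<^sup>2 + 1))"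
    have pos: "2 * C\<^sup>2 + 1 > 0"
      using zero_le_power2[of C] by linarith
    have \<eta>: "0 < \<eta>" "\<eta> < \<delta>" "\<eta> \<le> e / (2 * C\<^sup>2 + 1)"
      using \<open>e > 0\<close> assms pos by (auto simp: \<eta>_def)
    have "2 * C\<^sup>2 * \<eta> \<le> (2 * C\<^sup>2 + 1) * \<eta>"
      using \<eta> by (intro mult_right_mono) auto
    also have "\<dots> \<le> e"
      using \<eta>(3) pos by (simp add: field_simps)
    finally show "(LBINT s:{\<delta><..<pi/2}. (?u s * cot s)\<^sup>2) \<le> 4 * (LBINT s:I0. (?v s)\<^sup>2) + e"
      using *[OF \<eta>(1,2)] by linarith
  qed
qed

section \<open>The functional expressing zeta through theta\<close>

lemma integrable_imp_set_integrable:
  fixes f :: "'a \<Rightarrow> real"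
  shows "integrable M f \<Longrightarrow> A \<in> sets M \<Longrightarrow> set_integrable M A f"
  unfolding set_integrable_def by (rule integrable_mult_indicator)

lemma set_integral_const_I0: "(LBINT s:I0. k) = pi / 2 * k"
proof -
  have "measure lborel I0 = pi / 2"
    using integral_cos_even[of 0] by (simp add: set_lebesgue_integral_def)
  then show ?thesis
    by (simp add: set_lebesgue_integral_def)
qed

text \<open>Clamping the angle keeps the source non-negative for every \<theta>, so the denominator
  of \<open>dens\<close> stays at least 1 for \<open>c \<ge> 0\<close>. The clamp is inactive once
  the angle is known to lie in [0, pi].\<close>

definition trunc_sin :: "real \<Rightarrow> real" where
  "trunc_sin t = sin (max 0 (min pi t))"

lemma trunc_sin_range: "0 \<le> trunc_sin t" "trunc_sin t \<le> 1"
  by (auto simp: trunc_sin_def intro!: sin_ge_zero)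

lemma trunc_sin_eq: "0 \<le> t \<Longrightarrow> t \<le> pi \<Longrightarrow> trunc_sin t = sin t"
  by (simp add: trunc_sin_def)

lemma trunc_sin_Lipschitz: "\<bar>trunc_sin x - trunc_sin y\<bar> \<le> \<bar>x - y\<bar>"
proof -
  have "\<bar>sin a - sin b\<bar> \<le> \<bar>a - b\<bar>" for a b :: real
  proof -
    have "\<bar>sin a - sin b\<bar> = 2 * (\<bar>sin ((a - b) / 2)\<bar> * \<bar>cos ((a + b) / 2)\<bar>)"
      by (simp add: sin_diff_sin abs_mult)
    also have "\<dots> \<le> 2 * (\<bar>(a - b) / 2\<bar> * 1)"
      by (intro mult_left_mono mult_mono abs_sin_x_le_abs_x) auto
    finally show ?thesis
      by simp
  qed
  from this[of "max 0 (min pi x)" "max 0 (min pi y)"] show ?thesis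
    unfolding trunc_sin_def by (auto simp: max_def min_def abs_if split: if_splits)
qed

lemma trunc_sin_measurable [measurable]: "trunc_sin \<in> borel_measurable borel"
  unfolding trunc_sin_def by measurable

lemma trunc_sin_tendsto: "(f \<longlongrightarrow> l) F \<Longrightarrow> ((\<lambda>x. trunc_sin (f x)) \<longlongrightarrow> trunc_sin l) F"
proof -
  assume "(f \<longlongrightarrow> l) F"
  moreover have "continuous_on UNIV trunc_sin"
    unfolding trunc_sin_def by (intro continuous_intros)
  ultimately show ?thesis
    by (auto intro: isCont_tendsto_compose simp: continuous_on_eq_continuous_at)
qed

text \<open>\<open>A\<close> encodes the cut-off of the cotangent: \<open>{\<delta>..<pi/2}\<close>
  in the approximate problems, \<open>I0\<close> in the limit.\<close>

definition src :: "real set \<Rightarrow> (real \<Rightarrow> real) \<Rightarrow> real \<Rightarrow> real" where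
  "src A \<theta> s = indicator A s * (trunc_sin (\<theta> s) * cot s)"

text \<open>\<open>\<zeta> = dens c A \<theta>\<close> solves \<open>\<zeta> = c * src A \<theta> * exp (- \<integral>\<zeta>)\<close>, since \<open>exp \<integral>\<zeta> = 1 + c \<integral> src A \<theta>\<close>.\<close>
definition dens :: "real \<Rightarrow> real set \<Rightarrow> (real \<Rightarrow> real) \<Rightarrow> real \<Rightarrow> real" where
  "dens c A \<theta> \<sigma> = c * src A \<theta> \<sigma> / (1 + c * (LBINT s:{0<..<\<sigma>}. src A \<theta> s))"

lemma src_nonneg: "A \<subseteq> I0 \<Longrightarrow> 0 \<le> src A \<theta> s"
  using cot_nonneg_pi_half[of s] trunc_sin_range(1)[of "\<theta> s"]
  by (auto simp: src_def indicator_def I0_def)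

lemma src_measurable [measurable]:
  assumes [measurable]: "A \<in> sets borel" "\<theta> \<in> borel_measurable borel"
  shows "src A \<theta> \<in> borel_measurable borel"
  unfolding src_def by measurable

lemma src_integral_nonneg: "A \<subseteq> I0 \<Longrightarrow> 0 \<le> (LBINT s:B. src A \<theta> s)"
  unfolding set_lebesgue_integral_def by (intro integral_nonneg_AE AE_I2) (auto simp: src_nonneg)

lemma dens_nonneg: "A \<subseteq> I0 \<Longrightarrow> 0 \<le> c \<Longrightarrow> 0 \<le> dens c A \<theta> \<sigma>"
  unfolding dens_def by (intro divide_nonneg_nonneg mult_nonneg_nonneg add_nonneg_nonneg src_nonneg src_integral_nonneg) auto

lemma dens_le_src: "dens c A \<theta> \<sigma> \<le> c * src A \<theta> \<sigma>" if "A \<subseteq> I0" "0 \<le> c"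
proof -
  have "c * src A \<theta> \<sigma> / (1 + c * (LBINT s:{0<..<\<sigma>}. src A \<theta> s)) \<le> c * src A \<theta> \<sigma> / 1"
    using that by (intro divide_left_mono) (auto simp: src_nonneg src_integral_nonneg intro!: add_pos_nonneg)
  then show ?thesis
    by (simp add: dens_def)
qed

text \<open>The primitive of a non-negative integrable function is monotone, hence Borel.\<close>

lemma dens_measurable:
  assumes [measurable]: "A \<in> sets borel" "\<theta> \<in> borel_measurable borel" and "A \<subseteq> I0"
    and int: "integrable lborel (src A \<theta>)"
  shows "dens c A \<theta> \<in> borel_measurable borel"
proof -
  have "mono (\<lambda>\<sigma>. LBINT s:{0<..<\<sigma>}. src A \<theta> s)"
    using int by (intro monoI set_integral_mono_subset src_nonneg[OF \<open>A \<subseteq> I0\<close>])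
      (auto intro!: integrable_imp_set_integrable)
  then have [measurable]: "(\<lambda>\<sigma>. LBINT s:{0<..<\<sigma>}. src A \<theta> s) \<in> borel_measurable borel"
    by (rule borel_measurable_mono)
  show ?thesis
    unfolding dens_def by measurable
qed

section \<open>The cut-off source and density: bounds and Lipschitz dependence on the angle\<close>

lemma src_cutoff_le: "src {\<delta>..<pi/2} \<theta> s \<le> indicator {\<delta>..<pi/2} s / \<delta>" if "0 < \<delta>"
proof (cases "s \<in> {\<delta>..<pi/2}")
  case True
  then have "trunc_sin (\<theta> s) * cot s \<le> 1 * (1 / s)"
    using that by (intro mult_mono trunc_sin_range cot_le_inverse cot_nonneg_pi_half) auto
  also have "\<dots> \<le> 1 / \<delta>"
    using True that by (simp add: field_simps)
  finally show ?thesis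
    using True by (simp add: src_def)
qed (simp add: src_def)

lemma cutoff_subset: "0 < \<delta> \<Longrightarrow> {\<delta>..<pi/2} \<subseteq> I0"
  by (auto simp: I0_def)

lemma src_cutoff_integrable:
  assumes "0 < \<delta>" and [measurable]: "\<theta> \<in> borel_measurable borel"
  shows "integrable lborel (src {\<delta>..<pi/2} \<theta>)"
proof -
  have "set_integrable lborel {\<delta>..<pi/2} (\<lambda>s. src {\<delta>..<pi/2} \<theta> s)"
  proof (rule set_integrable_bounded_lborel[where B="1 / \<delta>"])
    show "\<bar>src {\<delta>..<pi/2} \<theta> s\<bar> \<le> 1 / \<delta>" if "s \<in> {\<delta>..<pi/2}" for s
      using src_cutoff_le[OF \<open>0 < \<delta>\<close>, of \<theta> s] src_nonneg[OF cutoff_subset[OF \<open>0 < \<delta>\<close>], of \<theta> s] that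
      by simp
  qed (auto intro: bounded_subset[OF bounded_I0 cutoff_subset[OF \<open>0 < \<delta>\<close>]])
  moreover have "(\<lambda>s. indicator {\<delta>..<pi/2} s *\<^sub>R src {\<delta>..<pi/2} \<theta> s) = src {\<delta>..<pi/2} \<theta>"
    by (auto simp: src_def indicator_def)
  ultimately show ?thesis
    by (simp only: set_integrable_def)
qed

lemma dens_cutoff_bound:
  assumes "0 < \<delta>" "0 \<le> c"
  shows "\<bar>dens c {\<delta>..<pi/2} \<theta> s\<bar> \<le> c / \<delta>"
proof -
  have "indicator {\<delta>..<pi/2} s / \<delta> \<le> 1 / \<delta>"
    using \<open>0 < \<delta>\<close> by (intro divide_right_mono) (auto simp: indicator_def)
  then have "c * src {\<delta>..<pi/2} \<theta> s \<le> c * (1 / \<delta>)"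
    using src_cutoff_le[OF assms(1), of \<theta> s] assms(2) by (intro mult_left_mono) auto
  then show ?thesis
    using dens_nonneg[OF cutoff_subset, of \<delta> c \<theta> s] dens_le_src[OF cutoff_subset, of \<delta> c \<theta> s] assms
    by auto
qed

text \<open>This provides the Lipschitz hypothesis of the finite-dimensional problem, so a constant
  that blows up with \<delta> is acceptable. The factor 2 bounds the length pi/2 of
  \<open>I0\<close>.\<close>

lemma dens_cutoff_Lipschitz:
  assumes "0 < \<delta>" "0 \<le> c" "0 \<le> d"
    and [measurable]: "\<theta> \<in> borel_measurable borel" "\<theta>' \<in> borel_measurable borel"
    and d: "\<And>s. s \<in> I0 \<Longrightarrow> \<bar>\<theta> s - \<theta>' s\<bar> \<le> d"
  shows "\<bar>dens c {\<delta>..<pi/2} \<theta> \<sigma> - dens c {\<delta>..<pi/2} \<theta>' \<sigma>\<bar> \<le> (c / \<delta> + 2 * (c / \<delta>)\<^sup>2) * d"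
proof -
  let ?A = "{\<delta>..<pi/2}"
  let ?g = "src ?A \<theta>" and ?g' = "src ?A \<theta>'"
  let ?G = "LBINT s:{0<..<\<sigma>}. ?g s" and ?G' = "LBINT s:{0<..<\<sigma>}. ?g' s"
  note sub = cutoff_subset[OF \<open>0 < \<delta>\<close>]
  have g: "\<bar>?g s - ?g' s\<bar> \<le> indicator ?A s * (d / \<delta>)" for s
  proof (cases "s \<in> ?A")
    case True
    then have "\<bar>?g s - ?g' s\<bar> = \<bar>trunc_sin (\<theta> s) - trunc_sin (\<theta>' s)\<bar> * cot s"
      using \<open>0 < \<delta>\<close> by (simp add: src_def abs_mult cot_nonneg_pi_half flip: left_diff_distrib)
    also have "\<dots> \<le> d * (1 / s)"
      using True sub \<open>0 < \<delta>\<close> d[of s]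
      by (intro mult_mono cot_le_inverse order_trans[OF trunc_sin_Lipschitz] cot_nonneg_pi_half) auto
    also have "\<dots> \<le> d * (1 / \<delta>)"
      using True \<open>0 < \<delta>\<close> \<open>0 \<le> d\<close> by (intro mult_left_mono) (auto simp: field_simps)
    finally show ?thesis
      using True by simp
  qed (simp add: src_def)
  have int: "set_integrable lborel {0<..<\<sigma>} ?g" "set_integrable lborel {0<..<\<sigma>} ?g'"
    using \<open>0 < \<delta>\<close> by (auto intro!: integrable_imp_set_integrable src_cutoff_integrable)
  have G: "\<bar>?G - ?G'\<bar> \<le> 2 * (d / \<delta>)"
  proof -
    have "\<bar>?G - ?G'\<bar> = \<bar>LBINT s:{0<..<\<sigma>}. ?g s - ?g' s\<bar>"
      using int by (simp add: set_integral_diff)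
    also have "\<dots> \<le> (LBINT s:{0<..<\<sigma>}. \<bar>?g s - ?g' s\<bar>)"
      using set_integral_norm_bound[OF set_integral_diff(1)[OF int]] by simp
    also have "\<dots> \<le> (LBINT s:I0. d / \<delta>)"
      unfolding set_lebesgue_integral_def
    proof (rule integral_mono)
      show "integrable lborel (\<lambda>s. indicator {0<..<\<sigma>} s *\<^sub>R \<bar>?g s - ?g' s\<bar>)"
        using set_integrable_abs[OF set_integral_diff(1)[OF int]] by (simp add: set_integrable_def)
      show "integrable lborel (\<lambda>s. indicator I0 s *\<^sub>R (d / \<delta>))"
        using isCont_set_integrable[of "\<lambda>_. d / \<delta>" I0] by (simp add: set_integrable_def)
      show "indicator {0<..<\<sigma>} s *\<^sub>R \<bar>?g s - ?g' s\<bar> \<le> indicator I0 s *\<^sub>R (d / \<delta>)" for s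
        using g[of s] sub \<open>0 \<le> d\<close> \<open>0 < \<delta>\<close> by (cases "s \<in> ?A"; cases "s \<in> I0") (auto simp: indicator_def)
    qed
    also have "(LBINT s:I0. d / \<delta>) = pi / 2 * (d / \<delta>)"
      by (rule set_integral_const_I0)
    also have "\<dots> \<le> 2 * (d / \<delta>)"
      using \<open>0 \<le> d\<close> \<open>0 < \<delta>\<close> pi_half_less_two by (intro mult_right_mono) auto
    finally show ?thesis .
  qed
  have G0: "0 \<le> c * ?G" "0 \<le> c * ?G'"
    using \<open>0 \<le> c\<close> by (auto intro!: mult_nonneg_nonneg src_integral_nonneg sub)
  define P where "P = c * (?g \<sigma> - ?g' \<sigma>) / (1 + c * ?G)"
  define Q where "Q = dens c ?A \<theta>' \<sigma> * (c * (?G' - ?G)) / (1 + c * ?G)"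
  have PQ: "dens c ?A \<theta> \<sigma> - dens c ?A \<theta>' \<sigma> = P + Q"
    using G0 by (simp add: P_def Q_def dens_def divide_simps) (simp add: algebra_simps)
  have "\<bar>P\<bar> \<le> \<bar>c * (?g \<sigma> - ?g' \<sigma>)\<bar> / 1"
    unfolding P_def abs_divide using G0 by (intro divide_left_mono) auto
  moreover have "\<bar>c * (?g \<sigma> - ?g' \<sigma>)\<bar> \<le> c * (d / \<delta>)"
  proof -
    have "indicator ?A \<sigma> * (d / \<delta>) \<le> 1 * (d / \<delta>)"
      using \<open>0 \<le> d\<close> \<open>0 < \<delta>\<close> by (intro mult_right_mono) (auto simp: indicator_def)
    then have "\<bar>?g \<sigma> - ?g' \<sigma>\<bar> \<le> d / \<delta>"
      using g[of \<sigma>] by linarith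
    then show ?thesis
      unfolding abs_mult using \<open>0 \<le> c\<close> by (intro mult_mono) auto
  qed
  ultimately have P: "\<bar>P\<bar> \<le> c * (d / \<delta>)"
    by linarith
  have "\<bar>Q\<bar> \<le> \<bar>dens c ?A \<theta>' \<sigma> * (c * (?G' - ?G))\<bar> / 1"
    unfolding Q_def abs_divide using G0 by (intro divide_left_mono) auto
  moreover have "\<bar>dens c ?A \<theta>' \<sigma>\<bar> * \<bar>c * (?G' - ?G)\<bar> \<le> (c / \<delta>) * (c * (2 * (d / \<delta>)))"
  proof (rule mult_mono)
    show "\<bar>dens c ?A \<theta>' \<sigma>\<bar> \<le> c / \<delta>"
      using assms by (intro dens_cutoff_bound)
    show "\<bar>c * (?G' - ?G)\<bar> \<le> c * (2 * (d / \<delta>))"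
      unfolding abs_mult using G \<open>0 \<le> c\<close> by (intro mult_mono) (auto simp: abs_minus_commute)
  qed (use assms in auto)
  ultimately have Q: "\<bar>Q\<bar> \<le> (c / \<delta>) * (c * (2 * (d / \<delta>)))"
    by (simp add: abs_mult)
  have "\<bar>P + Q\<bar> \<le> c * (d / \<delta>) + (c / \<delta>) * (c * (2 * (d / \<delta>)))"
    using P Q by linarith
  also have "\<dots> = (c / \<delta> + 2 * (c / \<delta>)\<^sup>2) * d"
    by (simp add: power2_eq_square field_simps)
  finally show ?thesis
    unfolding PQ .
qed

section \<open>Approximate solutions and the a priori bound\<close>

text \<open>The factor \<open>4 / pi\<close> is the reciprocal of the squared norm pi/4 of each mode
  on \<open>I0\<close>.\<close>

definition sine_coeff :: "(real \<Rightarrow> real) \<Rightarrow> nat \<Rightarrow> real" where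
  "sine_coeff f m = 4 / pi * (LBINT s:I0. f s * sin (2 * (real m + 1) * s))"

lemma bounded_sin_set_integrable:
  assumes [measurable]: "f \<in> borel_measurable borel" and "\<And>s. s \<in> I0 \<Longrightarrow> \<bar>f s\<bar> \<le> B"
  shows "set_integrable lborel I0 (\<lambda>s. f s * sin (k * s))"
proof (rule set_integrable_bounded_lborel[where B="B * 1"])
  show "\<bar>f s * sin (k * s)\<bar> \<le> B * 1" if "s \<in> I0" for s
    unfolding abs_mult using assms(2)[OF that] by (intro mult_mono) auto
qed auto

lemma sine_coeff_bound:
  assumes [measurable]: "f \<in> borel_measurable borel" and B: "\<And>s. s \<in> I0 \<Longrightarrow> \<bar>f s\<bar> \<le> B"
  shows "\<bar>sine_coeff f m\<bar> \<le> 2 * B"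
proof -
  have "\<bar>LBINT s:I0. f s * sin (2 * (real m + 1) * s)\<bar> \<le> (LBINT s:I0. \<bar>f s * sin (2 * (real m + 1) * s)\<bar>)"
    using set_integral_norm_bound[OF bounded_sin_set_integrable[OF assms]] by simp
  also have "\<dots> \<le> (LBINT s:I0. B)"
  proof (rule set_integral_mono)
    show "\<bar>f s * sin (2 * (real m + 1) * s)\<bar> \<le> B" if "s \<in> I0" for s
    proof -
      have "\<bar>f s\<bar> * \<bar>sin (2 * (real m + 1) * s)\<bar> \<le> B * 1"
        using B[OF that] by (intro mult_mono) auto
      then show ?thesis
        by (simp add: abs_mult)
    qed
  qed (auto intro!: set_integrable_abs bounded_sin_set_integrable[OF assms] isCont_set_integrable)
  finally show ?thesis
    unfolding set_integral_const_I0 by (simp add: sine_coeff_def abs_mult field_simps)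
qed

lemma sine_coeff_diff:
  assumes "f \<in> borel_measurable borel" "\<And>s. s \<in> I0 \<Longrightarrow> \<bar>f s\<bar> \<le> B"
    and "g \<in> borel_measurable borel" "\<And>s. s \<in> I0 \<Longrightarrow> \<bar>g s\<bar> \<le> B"
  shows "sine_coeff f m - sine_coeff g m = sine_coeff (\<lambda>s. f s - g s) m"
  using bounded_sin_set_integrable[OF assms(1,2)] bounded_sin_set_integrable[OF assms(3,4)]
  by (simp add: sine_coeff_def left_diff_distrib set_integral_diff right_diff_distrib)

lemma sin_poly_diff_le:
  assumes "\<And>m. m < N \<Longrightarrow> \<bar>\<beta> m - \<beta>' m\<bar> \<le> d"
  shows "\<bar>sin_poly N \<beta> x - sin_poly N \<beta>' x\<bar> \<le> real N * d"
proof -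
  have "\<bar>sin_poly N \<beta> x - sin_poly N \<beta>' x\<bar> =
      \<bar>\<Sum>m<N. (\<beta> m - \<beta>' m) / (2 * (real m + 1)) * sin (2 * (real m + 1) * x)\<bar>"
    by (simp add: sin_poly_def sum_subtractf diff_divide_distrib left_diff_distrib)
  also have "\<dots> \<le> (\<Sum>m<N. d)"
  proof (rule order_trans[OF sum_abs sum_mono])
    fix m assume m: "m \<in> {..<N}"
    have "\<bar>\<beta> m - \<beta>' m\<bar> / (2 * (real m + 1)) \<le> \<bar>\<beta> m - \<beta>' m\<bar> / 1"
      by (intro divide_left_mono) auto
    also have "\<dots> \<le> d"
      using assms m by simp
    finally have "\<bar>\<beta> m - \<beta>' m\<bar> / (2 * (real m + 1)) * \<bar>sin (2 * (real m + 1) * x)\<bar> \<le> d * 1"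
      using order_trans[OF abs_ge_zero assms] m by (intro mult_mono) auto
    then show "\<bar>(\<beta> m - \<beta>' m) / (2 * (real m + 1)) * sin (2 * (real m + 1) * x)\<bar> \<le> d"
      by (simp add: abs_mult)
  qed
  finally show ?thesis
    by simp
qed

lemma dens_cutoff_measurable:
  assumes "0 < \<delta>" "\<theta> \<in> borel_measurable borel"
  shows "dens c {\<delta>..<pi/2} \<theta> \<in> borel_measurable borel"
  using assms by (intro dens_measurable src_cutoff_integrable cutoff_subset) auto

text \<open>The unknowns are the first \<open>N\<close> sine coefficients \<open>x\<close> of the
  density: they fix the angle \<open>th x\<close>, which fixes a density, whose coefficients are
  \<open>f x\<close>. An approximate fixed point of \<open>f\<close> solves the angle equation
  approximately.\<close>

lemma approximant_exists:
  assumes "0 < \<delta>" "0 \<le> c" "0 < e" "0 \<le> r" "r \<le> 1"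
  obtains \<theta> where "\<theta> \<in> borel_measurable borel"
    and "\<And>\<sigma>. \<bar>\<theta> \<sigma> - (\<sigma> + 1/3 * sin_poly N (\<lambda>m. r ^ Suc m * sine_coeff (dens c {\<delta>..<pi/2} \<theta>) m) \<sigma>)\<bar> \<le> e"
proof -
  define th where "th x \<sigma> = \<sigma> + 1/3 * sin_poly N (\<lambda>m. r ^ Suc m * x m) \<sigma>" for x \<sigma>
  have th_meas [measurable]: "th x \<in> borel_measurable borel" for x
    unfolding th_def by measurable
  define f where "f x m = sine_coeff (dens c {\<delta>..<pi/2} (th x)) m" for x m
  \<comment> \<open>\<open>sine_coeff_bound\<close> doubles the bound \<open>c / \<delta>\<close>;
    the added 1 keeps \<open>M\<close> positive when \<open>c = 0\<close>.\<close>
  define M where "M = 2 * (c / \<delta>) + 1"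
  define L where "L = 2 * ((c / \<delta> + 2 * (c / \<delta>)\<^sup>2) * real N)"
  have th_lip: "\<bar>th x \<sigma> - th y \<sigma>\<bar> \<le> real N * d" if "\<forall>m<N. \<bar>x m - y m\<bar> \<le> d" for x y d \<sigma>
  proof -
    have "\<bar>sin_poly N (\<lambda>m. r ^ Suc m * x m) \<sigma> - sin_poly N (\<lambda>m. r ^ Suc m * y m) \<sigma>\<bar> \<le> real N * d"
    proof (rule sin_poly_diff_le)
      fix m assume "m < N"
      have "r ^ Suc m * \<bar>x m - y m\<bar> \<le> 1 * d"
        using assms that \<open>m < N\<close> by (intro mult_mono power_le_one) auto
      moreover have "\<bar>r ^ Suc m * x m - r ^ Suc m * y m\<bar> = r ^ Suc m * \<bar>x m - y m\<bar>"
        using assms by (simp add: abs_mult flip: right_diff_distrib)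
      ultimately show "\<bar>r ^ Suc m * x m - r ^ Suc m * y m\<bar> \<le> d"
        by simp
    qed
    moreover have "0 \<le> real N * d"
      using calculation abs_ge_zero by (rule order_trans[rotated])
    ultimately show ?thesis
      unfolding th_def by (auto simp: abs_le_iff)
  qed
  \<comment> \<open>Passing from coefficients to angles costs a factor \<open>N\<close>, hence the
    tolerance \<open>e / (N + 1)\<close>, which also makes sense for \<open>N = 0\<close>.\<close>
  obtain x where x: "\<forall>i<N. \<bar>f x i - x i\<bar> \<le> e / (real N + 1)"
  proof (rule approximate_fixed_point_cube[of M L "e / (real N + 1)" N f])
    show "M > 0" "L \<ge> 0" "e / (real N + 1) > 0"
      using assms by (auto simp: M_def L_def intro!: add_nonneg_pos add_nonneg_nonneg divide_nonneg_nonneg)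
    show "\<bar>f x i\<bar> \<le> M" for x i
      using sine_coeff_bound[OF dens_cutoff_measurable dens_cutoff_bound, of \<delta> "th x" c i] assms
      by (simp add: f_def M_def)
    show "\<bar>f x i - f y i\<bar> \<le> L * d" if "\<forall>j<N. \<bar>x j - y j\<bar> \<le> d" "i < N" for x y d i
    proof -
      have "0 \<le> d"
        using that by (meson abs_ge_zero order_trans)
      have "\<bar>f x i - f y i\<bar> = \<bar>sine_coeff (\<lambda>s. dens c {\<delta>..<pi/2} (th x) s - dens c {\<delta>..<pi/2} (th y) s) i\<bar>"
        using assms unfolding f_def
        by (subst sine_coeff_diff[where B="c / \<delta>"]) (auto intro!: dens_cutoff_measurable dens_cutoff_bound)
      also have "\<dots> \<le> 2 * ((c / \<delta> + 2 * (c / \<delta>)\<^sup>2) * (real N * d))"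
        using assms \<open>0 \<le> d\<close>
        by (intro sine_coeff_bound borel_measurable_diff dens_cutoff_measurable dens_cutoff_Lipschitz th_lip that)
          auto
      finally show ?thesis
        by (simp add: L_def mult_ac)
    qed
  qed auto
  show thesis
  proof (rule that[of "th x"])
    fix \<sigma>
    have "\<bar>th x \<sigma> - th (f x) \<sigma>\<bar> \<le> real N * (e / (real N + 1))"
      using x by (intro th_lip) (auto simp: abs_minus_commute)
    also have "\<dots> \<le> e"
      using \<open>0 < e\<close> by (simp add: field_simps)
    finally show "\<bar>th x \<sigma> - (\<sigma> + 1/3 * sin_poly N (\<lambda>m. r ^ Suc m * sine_coeff (dens c {\<delta>..<pi/2} (th x)) m) \<sigma>)\<bar> \<le> e"
      by (simp add: f_def th_def)
  qed auto
qed

text \<open>The bound does not depend on \<delta>, \<open>r\<close> or \<open>N\<close>. The norm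
  \<open>X\<close> satisfies \<open>X \<le> c * (1 + 2/3 * X)\<close>, while the hypothesis on
  \<open>c\<close> says that the reverse inequality holds at \<open>9 * sqrt pi / 2\<close>; as
  \<open>2 * c / 3 < 1\<close>, larger \<open>X\<close> are impossible.\<close>

lemma approximant_bound:
  assumes "0 < \<delta>" "\<delta> < pi / 2" "0 \<le> c" "0 \<le> r" "r \<le> 1"
    and c: "c * (1 + 3 * sqrt pi) \<le> 9 * sqrt pi / 2"
    and \<theta>: "\<theta> \<in> borel_measurable borel"
    and \<zeta>: "\<zeta> = dens c {\<delta>..<pi/2} \<theta>"
    and \<beta>: "\<beta> = (\<lambda>m. r ^ Suc m * sine_coeff \<zeta> m)"
    and close: "\<And>\<sigma>. \<bar>\<theta> \<sigma> - (\<sigma> + 1/3 * sin_poly N \<beta> \<sigma>)\<bar> \<le> \<delta> / 20"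
  shows "sqrt (LBINT s:I0. (\<zeta> s)\<^sup>2) \<le> 9 * sqrt pi / 2"
    and "sqrt (LBINT s:I0. (cos_poly N \<beta> s)\<^sup>2) \<le> 9 * sqrt pi / 2"
proof -
  let ?A = "{\<delta>..<pi/2}"
  note sub = cutoff_subset[OF \<open>0 < \<delta>\<close>]
  define X where "X = sqrt (LBINT s:I0. (\<zeta> s)\<^sup>2)"
  define D where "D = sqrt (LBINT s:I0. (cos_poly N \<beta> s)\<^sup>2)"
  define h where "h s = indicator ?A s * \<bar>sin_poly N \<beta> s * cot s\<bar>" for s
  define C where "C = (\<Sum>m<N. \<bar>\<beta> m\<bar>)"
  have \<zeta>_meas [measurable]: "\<zeta> \<in> borel_measurable borel"
    using assms unfolding \<zeta> by (intro dens_cutoff_measurable) auto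
  have [measurable]: "h \<in> borel_measurable borel"
    unfolding h_def by measurable
  have \<zeta>_nonneg: "0 \<le> \<zeta> s" for s
    using assms sub unfolding \<zeta> by (intro dens_nonneg) auto
  have \<zeta>_bound: "\<bar>\<zeta> s\<bar> \<le> c / \<delta>" for s
    using assms unfolding \<zeta> by (intro dens_cutoff_bound) auto
  have nonneg: "0 \<le> (LBINT s:I0. (g s)\<^sup>2)" for g :: "real \<Rightarrow> real"
    unfolding set_lebesgue_integral_def by (auto intro!: integral_nonneg_AE)
  have X0: "0 \<le> X" "0 \<le> D" and X2: "X\<^sup>2 = (LBINT s:I0. (\<zeta> s)\<^sup>2)" and D2: "D\<^sup>2 = (LBINT s:I0. (cos_poly N \<beta> s)\<^sup>2)"
    using nonneg by (auto simp: X_def D_def)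
  \<comment> \<open>The Abel weights lie in [0, 1], so they only shrink the coefficients before
    Bessel's inequality is applied.\<close>
  have DX: "D \<le> X"
  proof -
    have "(\<beta> m)\<^sup>2 \<le> (sine_coeff \<zeta> m)\<^sup>2" for m
    proof -
      have "r ^ Suc m * \<bar>sine_coeff \<zeta> m\<bar> \<le> 1 * \<bar>sine_coeff \<zeta> m\<bar>"
        using assms by (intro mult_right_mono power_le_one) auto
      then show ?thesis
        using assms by (auto simp: abs_le_square_iff[symmetric] \<beta> abs_mult)
    qed
    then have "(LBINT s:I0. (cos_poly N \<beta> s)\<^sup>2) \<le> pi / 4 * (\<Sum>m<N. (sine_coeff \<zeta> m)\<^sup>2)"
      unfolding norm_cos_poly by (intro mult_left_mono sum_mono) auto
    also have "\<dots> \<le> (LBINT s:I0. (\<zeta> s)\<^sup>2)"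
      by (rule Bessel_sin[OF _ \<zeta>_bound]) (auto simp: sine_coeff_def)
    finally show ?thesis
      unfolding D_def X_def by (rule real_sqrt_le_mono)
  qed
  have h_bound: "\<bar>h s\<bar> \<le> C" for s
  proof (cases "s \<in> ?A")
    case True
    then have s: "0 < s" "s \<le> pi / 2"
      using \<open>0 < \<delta>\<close> by auto
    have "\<bar>sin_poly N \<beta> s * cot s\<bar> \<le> (C * s) * (1 / s)"
      unfolding abs_mult using s sin_poly_linear_bound[of N \<beta> s] cot_le_inverse[OF s]
        cot_nonneg_pi_half[OF s]
      by (intro mult_mono) (auto simp: C_def sum_nonneg)
    then show ?thesis
      using True s by (simp add: h_def)
  qed (auto simp: h_def C_def sum_nonneg)
  have int_prod: "set_integrable lborel I0 (\<lambda>s. f s * g s)"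
    if [measurable]: "f \<in> borel_measurable borel" "g \<in> borel_measurable borel"
      and "\<And>s. \<bar>f s\<bar> \<le> F" "\<And>s. \<bar>g s\<bar> \<le> G" for f g :: "real \<Rightarrow> real" and F G
  proof (rule set_integrable_bounded_lborel)
    show "\<bar>f s * g s\<bar> \<le> F * G" for s
      unfolding abs_mult using that(3,4)[of s] by (intro mult_mono) auto
  qed auto
  \<comment> \<open>\<open>cos s\<close> is \<open>sin s * cot s\<close>, and 1/20 absorbs the angle
    error \<open>\<delta> / 20\<close> multiplied by \<open>cot s \<le> 1 / \<delta>\<close>. The
    squared norm pi/4 of the cosine leaves room for this term below 1.\<close>
  define k where "k s = cos s + 1 / 20" for s :: real
  have k_bound: "\<bar>k s\<bar> \<le> 2" for s
    using abs_cos_le_one[of s] unfolding k_def by linarith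
  have [measurable]: "k \<in> borel_measurable borel"
    unfolding k_def by measurable
  have k2: "sqrt (LBINT s:I0. (k s)\<^sup>2) \<le> 1"
  proof -
    have "(LBINT s:{0<..<pi/2}. (k s)\<^sup>2) =
      (\<lambda>x. x/2 + sin x * cos x / 2 + sin x / 10 + x / 400) (pi/2) - (\<lambda>x. x/2 + sin x * cos x / 2 + sin x / 10 + x / 400) 0"
    proof (rule set_integral_FTC_open(2))
      fix x :: real
      have "(cos x)\<^sup>2 = 1 / 2 + ((cos x)\<^sup>2 - (sin x)\<^sup>2) / 2"
        using sin_cos_squared_add[of x] by (simp add: field_simps)
      then have "(k x)\<^sup>2 = 1 / 2 + (cos x * cos x - sin x * sin x) / 2 + cos x / 10 + 1 / 400"
        unfolding k_def by (simp add: power2_eq_square algebra_simps)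
      then show "((\<lambda>x. x/2 + sin x * cos x / 2 + sin x / 10 + x / 400) has_real_derivative (k x)\<^sup>2) (at x)"
        by (auto intro!: derivative_eq_intros)
      show "isCont (\<lambda>s. (k s)\<^sup>2) x"
        unfolding k_def by (intro continuous_intros)
    qed simp
    then have "(LBINT s:I0. (k s)\<^sup>2) = pi / 4 + 1 / 10 + pi / 800"
      by (simp add: I0_def)
    also have "\<dots> \<le> 1"
      using pi_approx(2) by simp
    finally show ?thesis
      by simp
  qed
  have h2: "sqrt (LBINT s:I0. (h s)\<^sup>2) \<le> 2 * D"
  proof -
    have "(LBINT s:I0. (h s)\<^sup>2) = (LBINT s:?A. (sin_poly N \<beta> s * cot s)\<^sup>2)"
      unfolding set_lebesgue_integral_def using sub
      by (intro Bochner_Integration.integral_cong) (auto simp: h_def indicator_def)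
    also have "\<dots> = (LBINT s:{\<delta><..<pi/2}. (sin_poly N \<beta> s * cot s)\<^sup>2)"
      by (rule set_integral_discrete_difference[where X="{\<delta>}"]) auto
    also have "\<dots> \<le> 4 * D\<^sup>2"
      unfolding D2 using assms by (intro Hardy_sin_poly) auto
    finally have "sqrt (LBINT s:I0. (h s)\<^sup>2) \<le> sqrt (4 * D\<^sup>2)"
      by (rule real_sqrt_le_mono)
    then show ?thesis
      using X0 by (simp add: real_sqrt_mult)
  qed
  \<comment> \<open>Comparing \<open>trunc_sin (\<theta> s)\<close> with \<open>sin s\<close> by the
    Lipschitz bound gives \<open>\<zeta> \<le> c * (k + h / 3)\<close>; the extra factor \<zeta>
    prepares Cauchy-Schwarz.\<close>
  have pointwise: "(\<zeta> s)\<^sup>2 \<le> c * (\<zeta> s * k s) + c / 3 * (\<zeta> s * h s)" if "s \<in> I0" for s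
  proof (cases "s \<in> ?A")
    case True
    then have s: "0 < s" "s \<le> pi / 2"
      using \<open>0 < \<delta>\<close> by auto
    have cot: "0 \<le> cot s" "cot s \<le> 1 / \<delta>"
    proof -
      show "0 \<le> cot s"
        using s by (rule cot_nonneg_pi_half)
      have "cot s \<le> 1 / s"
        using s by (rule cot_le_inverse)
      also have "\<dots> \<le> 1 / \<delta>"
        using True \<open>0 < \<delta>\<close> by (simp add: field_simps)
      finally show "cot s \<le> 1 / \<delta>" .
    qed
    have "trunc_sin (\<theta> s) \<le> trunc_sin s + \<bar>\<theta> s - s\<bar>"
      using trunc_sin_Lipschitz[of "\<theta> s" s] by linarith
    also have "\<dots> \<le> sin s + \<bar>sin_poly N \<beta> s\<bar> / 3 + \<delta> / 20"
    proof -
      have "\<bar>\<theta> s - s\<bar> \<le> \<bar>sin_poly N \<beta> s\<bar> / 3 + \<delta> / 20"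
        using close[of s] by linarith
      moreover have "trunc_sin s = sin s"
        using s by (intro trunc_sin_eq) auto
      ultimately show ?thesis
        by linarith
    qed
    finally have "trunc_sin (\<theta> s) * cot s \<le> (sin s + \<bar>sin_poly N \<beta> s\<bar> / 3 + \<delta> / 20) * cot s"
      using cot by (intro mult_right_mono) auto
    also have "\<dots> = sin s * cot s + \<bar>sin_poly N \<beta> s\<bar> * cot s / 3 + \<delta> / 20 * cot s"
      by (simp add: algebra_simps)
    also have "sin s * cot s = cos s"
      using sin_gt_zero[of s] s by (simp add: cot_def)
    also have "\<delta> / 20 * cot s \<le> \<delta> / 20 * (1 / \<delta>)"
      using cot \<open>0 < \<delta>\<close> by (intro mult_left_mono) auto
    finally have "src ?A \<theta> s \<le> k s + h s / 3"
      using True \<open>0 < \<delta>\<close> cot by (simp add: src_def k_def h_def abs_mult)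
    then have "c * src ?A \<theta> s \<le> c * (k s + h s / 3)"
      using \<open>0 \<le> c\<close> by (rule mult_left_mono)
    then have "\<zeta> s \<le> c * (k s + h s / 3)"
      using dens_le_src[OF sub \<open>0 \<le> c\<close>, of \<theta> s] unfolding \<zeta> by linarith
    then have "\<zeta> s * \<zeta> s \<le> \<zeta> s * (c * (k s + h s / 3))"
      using \<zeta>_nonneg by (rule mult_left_mono)
    then show ?thesis
      by (simp add: power2_eq_square algebra_simps)
  next
    case False
    then have "\<zeta> s = 0"
      by (simp add: \<zeta> dens_def src_def)
    then show ?thesis
      by simp
  qed
  have int\<zeta>k: "set_integrable lborel I0 (\<lambda>s. \<zeta> s * k s)"
    by (rule int_prod[OF _ _ \<zeta>_bound k_bound]) auto
  have int\<zeta>h: "set_integrable lborel I0 (\<lambda>s. \<zeta> s * h s)"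
    by (rule int_prod[OF _ _ \<zeta>_bound h_bound]) auto
  have int2: "set_integrable lborel I0 (\<lambda>s. (\<zeta> s)\<^sup>2)" "set_integrable lborel I0 (\<lambda>s. (k s)\<^sup>2)"
     "set_integrable lborel I0 (\<lambda>s. (h s)\<^sup>2)"
    unfolding power2_eq_square
    using int_prod[OF _ _ \<zeta>_bound \<zeta>_bound] int_prod[OF _ _ k_bound k_bound] int_prod[OF _ _ h_bound h_bound]
    by auto
  have "X\<^sup>2 \<le> (LBINT s:I0. c * (\<zeta> s * k s) + c / 3 * (\<zeta> s * h s))"
    unfolding X2 using int2(1) int\<zeta>k int\<zeta>h pointwise by (intro set_integral_mono) auto
  also have "\<dots> = c * (LBINT s:I0. \<zeta> s * k s) + c / 3 * (LBINT s:I0. \<zeta> s * h s)"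
    using int\<zeta>k int\<zeta>h by (simp add: set_integral_add)
  finally have X2_le: "X\<^sup>2 \<le> c * (LBINT s:I0. \<zeta> s * k s) + c / 3 * (LBINT s:I0. \<zeta> s * h s)" .
  have \<zeta>k: "(LBINT s:I0. \<zeta> s * k s) \<le> X * 1"
  proof -
    have "\<bar>LBINT s:I0. \<zeta> s * k s\<bar> \<le> X * sqrt (LBINT s:I0. (k s)\<^sup>2)"
      unfolding X_def using int2 int\<zeta>k by (intro Cauchy_Schwarz_set_integral)
    also have "\<dots> \<le> X * 1"
      using k2 X0 by (intro mult_left_mono)
    finally show ?thesis
      by linarith
  qed
  have \<zeta>h: "(LBINT s:I0. \<zeta> s * h s) \<le> X * (2 * X)"
  proof -
    have "\<bar>LBINT s:I0. \<zeta> s * h s\<bar> \<le> X * sqrt (LBINT s:I0. (h s)\<^sup>2)"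
      unfolding X_def using int2 int\<zeta>h by (intro Cauchy_Schwarz_set_integral)
    also have "\<dots> \<le> X * (2 * X)"
      using h2 X0 DX by (intro mult_left_mono) auto
    finally show ?thesis
      by linarith
  qed
  have "c * (LBINT s:I0. \<zeta> s * k s) \<le> c * (X * 1)" "c / 3 * (LBINT s:I0. \<zeta> s * h s) \<le> c / 3 * (X * (2 * X))"
    using \<zeta>k \<zeta>h \<open>0 \<le> c\<close> by (auto intro!: mult_left_mono)
  with X2_le have "X\<^sup>2 \<le> c * (X * 1) + c / 3 * (X * (2 * X))"
    by linarith
  then have *: "X * X \<le> X * (c + 2 * c / 3 * X)"
    by (simp add: power2_eq_square algebra_simps)
  have "X \<le> 9 * sqrt pi / 2"
  proof (rule ccontr)
    assume "\<not> X \<le> 9 * sqrt pi / 2"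
    then have gt: "9 * sqrt pi / 2 < X"
      by simp
    moreover have "0 < sqrt pi"
      by simp
    ultimately have "0 < X"
      by linarith
    then have "X \<le> c + 2 * c / 3 * X"
      using * by simp
    then have "(1 - 2 * c / 3) * X \<le> c"
      by (simp add: algebra_simps)
    \<comment> \<open>The hypothesis on \<open>c\<close> rearranges to
      \<open>3 * sqrt pi * (c - 3/2) \<le> - c\<close>, which forces \<open>c < 3/2\<close> unless
      \<open>c = 0\<close>.\<close>
    moreover have "2 * c / 3 < 1"
    proof -
      have "c * (3 * sqrt pi) \<le> 9 * sqrt pi / 2 - c"
        using c by (simp add: algebra_simps)
      then have "3 * sqrt pi * (c - 3 / 2) \<le> - c"
        by (simp add: algebra_simps)
      show ?thesis
      proof (cases "c = 0")
        case False
        then have "3 * sqrt pi * (c - 3 / 2) < 0"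
          using \<open>0 \<le> c\<close> \<open>3 * sqrt pi * (c - 3 / 2) \<le> - c\<close> by linarith
        then have "c - 3 / 2 < 0"
          by (simp add: mult_less_0_iff)
        then show ?thesis
          by simp
      qed simp
    qed
    ultimately have "(1 - 2 * c / 3) * (9 * sqrt pi / 2) < c"
      using gt by (smt (verit) mult_strict_left_mono)
    then show False
      using c by (simp add: algebra_simps)
  qed
  then show "sqrt (LBINT s:I0. (\<zeta> s)\<^sup>2) \<le> 9 * sqrt pi / 2"
    "sqrt (LBINT s:I0. (cos_poly N \<beta> s)\<^sup>2) \<le> 9 * sqrt pi / 2"
    using DX unfolding X_def D_def by linarith+
qed

section \<open>The logarithmic kernel\<close>

text \<open>This is the squared modulus of \<open>1 - r * cis x\<close>, the denominator of the
  Poisson kernel.\<close>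

definition Poisson_denom :: "real \<Rightarrow> real \<Rightarrow> real" where
  "Poisson_denom r x = 1 + r\<^sup>2 - 2 * r * cos x"

text \<open>Abel regularisation of \<open>K\<close>: for \<open>r = 1\<close> the two denominators
  are \<open>4 * sin^2\<close> of \<open>s + \<sigma>\<close> and \<open>s - \<sigma>\<close>, and
  the final division by 2 undoes the squares.\<close>

definition K_abel :: "real \<Rightarrow> real \<Rightarrow> real \<Rightarrow> real" where
  "K_abel r s \<sigma> = ln (Poisson_denom r (2 * (s + \<sigma>)) / Poisson_denom r (2 * (s - \<sigma>))) / 2"

definition K_part :: "real \<Rightarrow> nat \<Rightarrow> real \<Rightarrow> real \<Rightarrow> real" where
  "K_part r N s \<sigma> = (\<Sum>m<N. 2 * r ^ Suc m / (real m + 1) * sin (2 * (real m + 1) * s) * sin (2 * (real m + 1) * \<sigma>))"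

lemma Poisson_denom_pos: "0 < Poisson_denom r x" if "0 \<le> r" "r < 1"
proof -
  have "2 * r * cos x \<le> 2 * r * 1"
    using that by (intro mult_left_mono) auto
  moreover have "0 < (1 - r)\<^sup>2"
    using that by simp
  ultimately show ?thesis
    by (simp add: Poisson_denom_def power2_eq_square algebra_simps)
qed

text \<open>Real part of the power series of \<open>- Ln (1 - r * cis x)\<close>.\<close>

lemma log_cos_series:
  assumes "0 \<le> r" "r < 1"
  shows "(\<lambda>m. r ^ Suc m / (real m + 1) * cos ((real m + 1) * x)) sums (- ln (Poisson_denom r x) / 2)"
proof -
  define z where "z = - complex_of_real r * cis x"
  have "cmod z < 1"
    using assms by (simp add: z_def norm_mult)
  then have "(\<lambda>n. - ((-z)^n) / of_nat n) sums Ln (1 + z)"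
    by (rule Ln_series')
  then have "(\<lambda>n. Re (- ((-z)^n) / of_nat n)) sums Re (Ln (1 + z))"
    by (rule sums_Re)
  moreover have "Re (- ((-z)^n) / of_nat n) = - (r ^ n / real n * cos (real n * x))" for n
    by (simp add: z_def power_mult_distrib Complex.DeMoivre flip: of_real_power)
  moreover have "Re (Ln (1 + z)) = ln (Poisson_denom r x) / 2"
  proof -
    have "(cmod (1 + z))\<^sup>2 = (1 - r * cos x)\<^sup>2 + (r * sin x)\<^sup>2"
      unfolding cmod_power2 by (simp add: z_def)
    also have "\<dots> = Poisson_denom r x"
      using sin_cos_squared_add[of x] unfolding Poisson_denom_def by algebra
    finally have "(cmod (1 + z))\<^sup>2 = Poisson_denom r x" .
    then have *: "cmod (1 + z) = sqrt (Poisson_denom r x)"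
      by (metis norm_ge_zero real_sqrt_unique)
    then have "1 + z \<noteq> 0"
      using Poisson_denom_pos[OF assms, of x] by auto
    then have "Re (Ln (1 + z)) = ln (sqrt (Poisson_denom r x))"
      by (simp add: *)
    then show ?thesis
      using Poisson_denom_pos[OF assms, of x] by (simp add: ln_sqrt)
  qed
  ultimately have "(\<lambda>n. - (r ^ n / real n * cos (real n * x))) sums (ln (Poisson_denom r x) / 2)"
    by (simp only:)
  then have "(\<lambda>n. r ^ n / real n * cos (real n * x)) sums - (ln (Poisson_denom r x) / 2)"
    using sums_minus by fastforce
  \<comment> \<open>The term of index 0 is a division by zero, thus 0, so shifting the index leaves
    the sum unchanged.\<close>
  then have "(\<lambda>n. r ^ Suc n / real (Suc n) * cos (real (Suc n) * x)) sums - (ln (Poisson_denom r x) / 2)"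
    by (subst sums_Suc_iff) simp
  then show ?thesis
    by (simp add: add.commute)
qed

lemma K_abel_series:
  assumes "0 \<le> r" "r < 1"
  shows "(\<lambda>m. 2 * r ^ Suc m / (real m + 1) * sin (2 * (real m + 1) * s) * sin (2 * (real m + 1) * \<sigma>)) sums K_abel r s \<sigma>"
proof -
  have "(\<lambda>m. r ^ Suc m / (real m + 1) * cos ((real m + 1) * (2 * (s - \<sigma>))) -
             r ^ Suc m / (real m + 1) * cos ((real m + 1) * (2 * (s + \<sigma>)))) sums
        (- ln (Poisson_denom r (2 * (s - \<sigma>))) / 2 - - ln (Poisson_denom r (2 * (s + \<sigma>))) / 2)"
    by (intro sums_diff log_cos_series assms)
  moreover have "- ln (Poisson_denom r (2 * (s - \<sigma>))) / 2 - - ln (Poisson_denom r (2 * (s + \<sigma>))) / 2 = K_abel r s \<sigma>"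
  proof -
    have "Poisson_denom r x \<noteq> 0" for x
      using Poisson_denom_pos[OF assms, of x] by simp
    then show ?thesis
      by (simp add: K_abel_def ln_div diff_divide_distrib)
  qed
  moreover have "r ^ Suc m / (real m + 1) * cos ((real m + 1) * (2 * (s - \<sigma>))) -
             r ^ Suc m / (real m + 1) * cos ((real m + 1) * (2 * (s + \<sigma>))) =
      2 * r ^ Suc m / (real m + 1) * sin (2 * (real m + 1) * s) * sin (2 * (real m + 1) * \<sigma>)" for m
  proof -
    have *: "cos ((real m + 1) * (2 * (s - \<sigma>))) - cos ((real m + 1) * (2 * (s + \<sigma>))) =
      2 * (sin (2 * (real m + 1) * s) * sin (2 * (real m + 1) * \<sigma>))"
    proof -
      have "(real m + 1) * (2 * (s - \<sigma>)) = 2 * (real m + 1) * s - 2 * (real m + 1) * \<sigma>"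
        "(real m + 1) * (2 * (s + \<sigma>)) = 2 * (real m + 1) * s + 2 * (real m + 1) * \<sigma>"
        by (simp_all add: algebra_simps)
      then show ?thesis
        by (simp only: cos_diff cos_add)
    qed
    show ?thesis
      unfolding right_diff_distrib[symmetric] * by simp
  qed
  ultimately show ?thesis
    by simp
qed

text \<open>A geometric series dominates the tail uniformly in \<open>s\<close> and \<sigma>, so
  \<open>N\<close> can be chosen from \<open>r\<close> and the tolerance alone.\<close>

lemma K_part_error:
  assumes "0 \<le> r" "r < 1"
  shows "\<bar>K_abel r s \<sigma> - K_part r N s \<sigma>\<bar> \<le> 2 * r ^ Suc N / (1 - r)"
proof -
  define f where "f m = 2 * r ^ Suc m / (real m + 1) * sin (2 * (real m + 1) * s) * sin (2 * (real m + 1) * \<sigma>)" for m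
  have "f sums K_abel r s \<sigma>"
    unfolding f_def by (rule K_abel_series[OF assms])
  then have 1: "(\<lambda>k. f (k + N)) sums (K_abel r s \<sigma> - K_part r N s \<sigma>)"
    unfolding K_part_def f_def[symmetric] by (subst sums_iff_shift) simp
  have "(\<lambda>k. 2 * r ^ Suc N * r ^ k) sums (2 * r ^ Suc N * (1 / (1 - r)))"
    using assms by (intro sums_mult geometric_sums) auto
  moreover have "norm (f (k + N)) \<le> 2 * r ^ Suc N * r ^ k" for k
  proof -
    have "\<bar>f m\<bar> \<le> 2 * r ^ Suc m" for m
    proof -
      have "\<bar>f m\<bar> = 2 * r ^ Suc m / (real m + 1) * \<bar>sin (2 * (real m + 1) * s)\<bar> * \<bar>sin (2 * (real m + 1) * \<sigma>)\<bar>"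
        using assms by (simp add: f_def abs_mult)
      also have "\<dots> \<le> 2 * r ^ Suc m / 1 * 1 * 1"
        using assms by (intro mult_mono divide_left_mono) auto
      finally show ?thesis
        by simp
    qed
    from this[of "k + N"] show ?thesis
      by (simp add: power_add mult_ac)
  qed
  ultimately have "norm (K_abel r s \<sigma> - K_part r N s \<sigma>) \<le> 2 * r ^ Suc N * (1 / (1 - r))"
    using 1 by (intro norm_sums_le[OF 1]) auto
  then show ?thesis
    by simp
qed

section \<open>Comparison of the Abel kernel with K\<close>

lemma cos_diff_gt_cos_sum:
  assumes "s \<in> I0" "\<sigma> \<in> I0" "s \<noteq> \<sigma>"
  shows "cos (2 * (s + \<sigma>)) < cos (2 * (s - \<sigma>))" "cos (2 * (s - \<sigma>)) < 1"
proof -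
  have "cos (2 * (s - \<sigma>)) - cos (2 * (s + \<sigma>)) = 2 * (sin (2 * s) * sin (2 * \<sigma>))"
    unfolding right_diff_distrib distrib_left cos_diff cos_add by simp
  moreover have "0 < sin (2 * s)" "0 < sin (2 * \<sigma>)"
    using assms by (auto simp: I0_def intro!: sin_gt_zero)
  ultimately show "cos (2 * (s + \<sigma>)) < cos (2 * (s - \<sigma>))"
    by (smt (verit) mult_pos_pos)
  have "sin (s - \<sigma>) \<noteq> 0"
    using assms sin_eq_0_pi[of "s - \<sigma>"] by (auto simp: I0_def)
  then have "0 < (sin (s - \<sigma>))\<^sup>2"
    by simp
  then show "cos (2 * (s - \<sigma>)) < 1"
    using cos_double_sin[of "s - \<sigma>"] by simp
qed

lemma K_eq_log_ratio:
  "K s \<sigma> = ln ((1 - cos (2 * (s + \<sigma>))) / (1 - cos (2 * (s - \<sigma>)))) / 2" if "s \<in> I0" "\<sigma> \<in> I0" "s \<noteq> \<sigma>"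
proof -
  have "(1 - cos (2 * (s + \<sigma>))) / (1 - cos (2 * (s - \<sigma>))) = (\<bar>sin (s + \<sigma>) / sin (s - \<sigma>)\<bar>)\<^sup>2"
    unfolding cos_double_sin by (simp add: power_divide)
  moreover have "0 < (1 - cos (2 * (s + \<sigma>))) / (1 - cos (2 * (s - \<sigma>)))"
    using cos_diff_gt_cos_sum[OF that] by (intro divide_pos_pos) auto
  ultimately have "0 < \<bar>sin (s + \<sigma>) / sin (s - \<sigma>)\<bar>"
    by (metis abs_ge_zero less_eq_real_def power2_eq_square mult_zero_left less_irrefl)
  then have "ln ((\<bar>sin (s + \<sigma>) / sin (s - \<sigma>)\<bar>)\<^sup>2) = 2 * K s \<sigma>"
    unfolding K_def by (simp add: ln_realpow)
  then show ?thesis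
    using \<open>_ = (\<bar>sin (s + \<sigma>) / sin (s - \<sigma>)\<bar>)\<^sup>2\<close> by simp
qed

text \<open>\<open>K\<close> itself majorises all regularisations, as dominated convergence
  requires. After cross-multiplication the upper bound is
  \<open>0 \<le> (1 - r)^2 * (?b - ?a)\<close>.\<close>

lemma K_abel_bounds:
  assumes "s \<in> I0" "\<sigma> \<in> I0" "s \<noteq> \<sigma>" "0 < r" "r < 1"
  shows "0 \<le> K_abel r s \<sigma>" "K_abel r s \<sigma> \<le> K s \<sigma>"
proof -
  let ?a = "cos (2 * (s + \<sigma>))" and ?b = "cos (2 * (s - \<sigma>))"
  have ab: "?a < ?b" "?b < 1"
    using cos_diff_gt_cos_sum[OF assms(1-3)] by auto
  have pos: "0 < Poisson_denom r x" for x
    using assms by (intro Poisson_denom_pos) auto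
  have "Poisson_denom r (2 * (s - \<sigma>)) \<le> Poisson_denom r (2 * (s + \<sigma>))"
    using ab assms by (simp add: Poisson_denom_def)
  then have "1 \<le> Poisson_denom r (2 * (s + \<sigma>)) / Poisson_denom r (2 * (s - \<sigma>))"
    using pos by simp
  then show "0 \<le> K_abel r s \<sigma>"
    by (simp add: K_abel_def)
  have "Poisson_denom r (2 * (s + \<sigma>)) * (1 - ?b) \<le> (1 - ?a) * Poisson_denom r (2 * (s - \<sigma>))"
  proof -
    have "0 \<le> (1 - r)\<^sup>2 * (?b - ?a)"
      using ab by simp
    then show ?thesis
      by (simp add: Poisson_denom_def power2_eq_square algebra_simps)
  qed
  then have "Poisson_denom r (2 * (s + \<sigma>)) / Poisson_denom r (2 * (s - \<sigma>)) \<le> (1 - ?a) / (1 - ?b)"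
    using pos[of "2 * (s - \<sigma>)"] ab by (simp add: divide_simps)
  moreover have "0 < Poisson_denom r (2 * (s + \<sigma>)) / Poisson_denom r (2 * (s - \<sigma>))"
    using pos by simp
  ultimately show "K_abel r s \<sigma> \<le> K s \<sigma>"
    unfolding K_abel_def K_eq_log_ratio[OF assms(1-3)] by (intro divide_right_mono) auto
qed

text \<open>Off the diagonal this follows from the Abel kernel; on it, division by zero and
  \<open>ln 0 = 0\<close> give the value 0.\<close>

lemma K_nonneg: "0 \<le> K s \<sigma>" if "s \<in> I0" "\<sigma> \<in> I0"
proof (cases "s = \<sigma>")
  case False
  then show ?thesis
    using K_abel_bounds[OF that False, of "1/2"] by simp
qed (simp add: K_def)

lemma K_abel_tendsto:
  assumes "s \<in> I0" "\<sigma> \<in> I0" "s \<noteq> \<sigma>" and r: "(r \<longlongrightarrow> 1) F"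
  shows "((\<lambda>k. K_abel (r k) s \<sigma>) \<longlongrightarrow> K s \<sigma>) F"
proof -
  have ab: "cos (2 * (s + \<sigma>)) < cos (2 * (s - \<sigma>))" "cos (2 * (s - \<sigma>)) < 1"
    using cos_diff_gt_cos_sum[OF assms(1-3)] by auto
  have lim: "((\<lambda>k. Poisson_denom (r k) x) \<longlongrightarrow> 2 * (1 - cos x)) F" for x
    unfolding Poisson_denom_def using r by (auto intro!: tendsto_eq_intros)
  have "((\<lambda>k. K_abel (r k) s \<sigma>) \<longlongrightarrow> ln ((2 * (1 - cos (2 * (s + \<sigma>)))) / (2 * (1 - cos (2 * (s - \<sigma>))))) / 2) F"
    unfolding K_abel_def using ab by (intro tendsto_intros lim) auto
  then show ?thesis
    unfolding K_eq_log_ratio[OF assms(1-3)] mult_divide_mult_cancel_left_if by simp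
qed

section \<open>Integrability of the kernel singularity\<close>

lemma half_le_sin: "x / 2 \<le> sin x" if "0 \<le> x" "x \<le> pi / 2" for x :: real
proof (cases "x = 0")
  case False
  then have x: "0 < x / 2" "x / 2 \<le> pi / 2"
    using that by auto
  have "0 < sin (x / 2)" "0 < cos (x / 2)"
    using x that False by (auto intro!: sin_gt_zero cos_gt_zero_pi)
  then have "x / 2 * cos (x / 2) \<le> sin (x / 2)"
    using cot_le_inverse[OF x] x by (simp add: cot_def field_simps)
  \<comment> \<open>By the double-angle formulas this reads
    \<open>x / 2 * (1 + cos x) \<le> sin x\<close>.\<close>
  then have "x / 2 * cos (x / 2) * (2 * cos (x / 2)) \<le> sin (x / 2) * (2 * cos (x / 2))"
    using \<open>0 < cos (x / 2)\<close> by (intro mult_right_mono) auto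
  moreover have "sin (x / 2) * (2 * cos (x / 2)) = sin x"
    using sin_double[of "x / 2"] by simp
  moreover have "x / 2 * cos (x / 2) * (2 * cos (x / 2)) = x / 2 * (1 + cos x)"
  proof -
    have "1 + cos x = cos (x / 2) * (2 * cos (x / 2))"
      using cos_double_cos[of "x / 2"] by (simp add: power2_eq_square)
    then show ?thesis
      by simp
  qed
  moreover have "x / 2 * 1 \<le> x / 2 * (1 + cos x)"
    using that cos_ge_zero[of x] by (intro mult_left_mono) auto
  ultimately show ?thesis
    by linarith
qed simp

text \<open>The kernel is at most \<open>ln (2 / x)\<close> with \<open>x\<close> the distance to
  the diagonal, and \<open>ln y = 2 * ln (sqrt y) \<le> 2 * sqrt y\<close> trades the logarithm for
  an inverse square root.\<close>

lemma K_le: "K s \<sigma> \<le> 3 / sqrt \<bar>s - \<sigma>\<bar>" if "s \<in> I0" "\<sigma> \<in> I0"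
proof (cases "s = \<sigma>")
  case False
  define x where "x = \<bar>s - \<sigma>\<bar>"
  have x: "0 < x" "x \<le> pi / 2"
    using that False by (auto simp: x_def I0_def abs_if)
  have sinx: "\<bar>sin (s - \<sigma>)\<bar> = sin x"
    using x sin_gt_zero[of x] sin_minus[of "s - \<sigma>"] by (auto simp: x_def abs_if split: if_splits)
  have "x / 2 \<le> sin x"
    using x by (intro half_le_sin) auto
  have "0 < sin (s + \<sigma>)"
    using that by (intro sin_gt_zero) (auto simp: I0_def)
  then have "0 < \<bar>sin (s + \<sigma>)\<bar> / sin x"
    using \<open>x / 2 \<le> sin x\<close> x by simp
  moreover have "\<bar>sin (s + \<sigma>)\<bar> / sin x \<le> 1 / (x / 2)"
    using \<open>x / 2 \<le> sin x\<close> x by (intro frac_le) auto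
  ultimately have "K s \<sigma> \<le> ln (2 / x)"
    unfolding K_def abs_divide sinx by (subst ln_le_cancel_iff) (use x in auto)
  also have "ln (2 / x) = 2 * ln (sqrt (2 / x))"
    using x by (simp add: ln_sqrt)
  also have "ln (sqrt (2 / x)) \<le> sqrt (2 / x)"
    using x by (intro order_trans[OF ln_le_minus_one]) auto
  also have "2 * sqrt (2 / x) \<le> 3 / sqrt x"
  proof -
    have "sqrt 2 \<le> 3 / 2"
      by (rule real_le_lsqrt) (auto simp: power2_eq_square)
    then have "2 * sqrt 2 \<le> 3"
      by simp
    then show ?thesis
      using x by (simp add: real_sqrt_divide divide_right_mono)
  qed
  finally show ?thesis
    by (simp add: x_def)
qed (simp add: K_def)

lemma K_measurable [measurable]: "(\<lambda>s. K s \<sigma>) \<in> borel_measurable borel"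
  unfolding K_def by measurable

lemma inverse_sqrt_integrable: "integrable lborel (\<lambda>x::real. indicator {0..2} x * (1 / sqrt x))"
proof -
  have "(\<lambda>x::real. x powr (-1/2)) absolutely_integrable_on {0..2}"
  proof (rule nonnegative_absolutely_integrable_1)
    show "(\<lambda>x::real. x powr (-1/2)) integrable_on {0..2}"
      by (rule integrable_on_powr_from_0) auto
  qed auto
  then have "integrable lborel (\<lambda>x. indicator {0..2} x *\<^sub>R x powr (-1/2 :: real))"
    by (simp add: set_integrable_def integrable_completion)
  moreover have "(\<lambda>x. indicator {0..2} x *\<^sub>R x powr (-1/2 :: real)) = (\<lambda>x::real. indicator {0..2} x * (1 / sqrt x))"
    by (auto simp: indicator_def powr_minus_divide powr_half_sqrt)
  ultimately show ?thesis
    by simp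
qed

lemma inverse_sqrt_I0_integrable: "set_integrable lborel I0 (\<lambda>s. 1 / sqrt s)"
proof -
  have "set_integrable lborel I0 (\<lambda>x::real. indicator {0..2} x * (1 / sqrt x))"
    by (rule integrable_imp_set_integrable[OF inverse_sqrt_integrable]) auto
  then show ?thesis
    using pi_half_less_two by (subst (asm) set_integrable_cong[where f'="\<lambda>s. 1 / sqrt s"]) (auto simp: I0_def)
qed

text \<open>The singularities at 0 and at \<sigma> are apart: for each \<open>s\<close> either
  \<open>s\<close> or its distance to \<sigma> is at least \<open>\<sigma> / 2\<close>. One factor
  is then at most \<open>sqrt (2 / \<sigma>)\<close>, and a sum of integrable functions dominates
  the product.\<close>

lemma K_inverse_sqrt_integrable:
  assumes \<sigma>: "\<sigma> \<in> I0"
  shows "set_integrable lborel I0 (\<lambda>s. K s \<sigma> * (1 / sqrt s))"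
proof -
  define \<psi> where "\<psi> x = indicator {0..2} x * (1 / sqrt x)" for x :: real
  have \<psi>: "integrable lborel \<psi>"
    unfolding \<psi>_def by (rule inverse_sqrt_integrable)
  \<comment> \<open>Both one-sided copies of \<psi> are used, since together they cover the inverse
    square root of the distance to \<sigma> on either side.\<close>
  have "integrable lborel (\<lambda>s. \<psi> (- \<sigma> + 1 * s))" "integrable lborel (\<lambda>s. \<psi> (\<sigma> + (-1) * s))"
    by (intro lborel_integrable_real_affine \<psi>; simp)+
  then have int: "integrable lborel (\<lambda>s. 3 * sqrt (2 / \<sigma>) * (\<psi> s + (\<psi> (- \<sigma> + s) + \<psi> (\<sigma> - s))))"
    using \<psi> by (intro integrable_mult_right integrable_add) auto
  have pos: "0 \<le> \<psi> x" for x
    by (simp add: \<psi>_def indicator_def)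
  have eq: "\<psi> x = 1 / sqrt x" if "0 \<le> x" "x \<le> 2" for x
    using that by (simp add: \<psi>_def)
  show ?thesis
  proof (rule set_integrable_bound[OF integrable_imp_set_integrable[OF int]])
    have "norm (K s \<sigma> * (1 / sqrt s)) \<le> norm (3 * sqrt (2 / \<sigma>) * (\<psi> s + (\<psi> (- \<sigma> + s) + \<psi> (\<sigma> - s))))"
      if s: "s \<in> I0" for s
    proof -
      define x where "x = \<bar>s - \<sigma>\<bar>"
      have bnds: "0 < s" "0 < \<sigma>" "s < 2" "x < 2" "0 \<le> x"
        using s \<sigma> pi_half_less_two by (auto simp: x_def I0_def)
      have inv: "1 / sqrt t \<le> sqrt (2 / \<sigma>)" if "\<sigma> / 2 \<le> t" for t
      proof -
        have "1 / t \<le> 2 / \<sigma>"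
          using that bnds by (simp add: field_simps)
        then have "sqrt (1 / t) \<le> sqrt (2 / \<sigma>)"
          by (rule real_sqrt_le_mono)
        then show ?thesis
          by (simp add: real_sqrt_divide)
      qed
      have *: "1 / sqrt s * (1 / sqrt x) \<le> sqrt (2 / \<sigma>) * (1 / sqrt s + 1 / sqrt x)"
      proof (cases "\<sigma> / 2 \<le> s")
        case True
        then have "1 / sqrt s \<le> sqrt (2 / \<sigma>)"
          by (rule inv)
        then have "1 / sqrt s * (1 / sqrt x) \<le> sqrt (2 / \<sigma>) * (1 / sqrt x)"
          using bnds by (intro mult_right_mono) auto
        also have "\<dots> \<le> sqrt (2 / \<sigma>) * (1 / sqrt s + 1 / sqrt x)"
          using bnds by (intro mult_left_mono) auto
        finally show ?thesis .
      next
        case False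
        then have "\<sigma> / 2 \<le> x"
          unfolding x_def by linarith
        then have "1 / sqrt x \<le> sqrt (2 / \<sigma>)"
          by (rule inv)
        then have "1 / sqrt s * (1 / sqrt x) \<le> 1 / sqrt s * sqrt (2 / \<sigma>)"
          using bnds by (intro mult_left_mono) auto
        also have "\<dots> = sqrt (2 / \<sigma>) * (1 / sqrt s)"
          by (rule mult.commute)
        also have "\<dots> \<le> sqrt (2 / \<sigma>) * (1 / sqrt s + 1 / sqrt x)"
          using bnds by (intro mult_left_mono) auto
        finally show ?thesis .
      qed
      have "1 / sqrt x \<le> \<psi> (- \<sigma> + s) + \<psi> (\<sigma> - s)"
        using eq[of x] bnds pos[of "- \<sigma> + s"] pos[of "\<sigma> - s"] by (auto simp: x_def abs_if split: if_splits)
      then have \<psi>_ge: "1 / sqrt s + 1 / sqrt x \<le> \<psi> s + (\<psi> (- \<sigma> + s) + \<psi> (\<sigma> - s))"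
        using eq[of s] bnds by simp
      have "K s \<sigma> * (1 / sqrt s) \<le> 3 / sqrt x * (1 / sqrt s)"
        using K_le[OF s \<sigma>] bnds by (intro mult_right_mono) (auto simp: x_def)
      also have "\<dots> = 3 * (1 / sqrt s * (1 / sqrt x))"
        by simp
      also have "\<dots> \<le> 3 * (sqrt (2 / \<sigma>) * (1 / sqrt s + 1 / sqrt x))"
        using * by (intro mult_left_mono) auto
      also have "\<dots> \<le> 3 * (sqrt (2 / \<sigma>) * (\<psi> s + (\<psi> (- \<sigma> + s) + \<psi> (\<sigma> - s))))"
        using \<psi>_ge bnds by (intro mult_left_mono) auto
      finally have "K s \<sigma> * (1 / sqrt s) \<le> 3 * (sqrt (2 / \<sigma>) * (\<psi> s + (\<psi> (- \<sigma> + s) + \<psi> (\<sigma> - s))))" .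
      moreover have "0 \<le> K s \<sigma> * (1 / sqrt s)"
        using K_nonneg[OF s \<sigma>] bnds by simp
      ultimately show ?thesis
        by simp
    qed
    then show "AE s in lborel. s \<in> I0 \<longrightarrow> norm (K s \<sigma> * (1 / sqrt s)) \<le>
        norm (3 * sqrt (2 / \<sigma>) * (\<psi> s + (\<psi> (- \<sigma> + s) + \<psi> (\<sigma> - s))))"
      by auto
  qed (auto simp: set_borel_measurable_def)
qed

section \<open>Passage to the limit\<close>

lemma set_integral_open_eq_integral:
  fixes f :: "real \<Rightarrow> real"
  assumes "set_integrable lborel {a..b} f"
  shows "(LBINT s:{a<..<b}. f s) = integral {a..b} f" "f integrable_on {a..b}"
proof -
  have "(LBINT s:{a<..<b}. f s) = (LBINT s:{a..b}. f s)"
    by (rule set_integral_discrete_difference[where X="{a, b}"]) auto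
  then show "(LBINT s:{a<..<b}. f s) = integral {a..b} f" "f integrable_on {a..b}"
    using set_borel_integral_eq_integral[OF assms] by auto
qed

text \<open>\<open>ln (1 + c * G)\<close> is a primitive of the density, \<open>G\<close> being the
  integral of the source. As the cotangent blows up at 0, it is differentiated only in the interior;
  integrability of the source makes \<open>G\<close> continuous up to 0.\<close>

lemma exp_integral_dens:
  assumes int: "integrable lborel (src I0 \<theta>)" and [measurable]: "\<theta> \<in> borel_measurable borel"
    and cont: "continuous_on I0 \<theta>" and "0 \<le> c" and \<sigma>: "\<sigma> \<in> I0"
  shows "exp (LBINT s:{0<..<\<sigma>}. dens c I0 \<theta> s) = 1 + c * (LBINT s:{0<..<\<sigma>}. src I0 \<theta> s)"
proof -
  let ?g = "src I0 \<theta>" and ?\<zeta> = "dens c I0 \<theta>"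
  define G where "G x = integral {0..x} ?g" for x
  have G_eq: "(LBINT s:{0<..<x}. ?g s) = G x" and g_int: "?g integrable_on {0..x}" for x
    using set_integral_open_eq_integral[OF integrable_imp_set_integrable[OF int], of 0 x] by (auto simp: G_def)
  have G_nonneg: "0 \<le> G x" for x
    unfolding G_eq[symmetric] by (rule src_integral_nonneg) simp
  have pos: "0 < 1 + c * G x" for x
    using G_nonneg \<open>0 \<le> c\<close> by (intro add_pos_nonneg) auto
  have meas: "?\<zeta> \<in> borel_measurable borel"
    using int by (intro dens_measurable) auto
  have \<zeta>_int: "set_integrable lborel {0..\<sigma>} ?\<zeta>"
  proof (rule set_integrable_bound[where f="\<lambda>s. c * ?g s"])
    show "set_integrable lborel {0..\<sigma>} (\<lambda>s. c * ?g s)"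
      using int by (intro integrable_imp_set_integrable) auto
    show "AE s in lborel. s \<in> {0..\<sigma>} \<longrightarrow> norm (?\<zeta> s) \<le> norm (c * ?g s)"
      using dens_le_src[OF order_refl \<open>0 \<le> c\<close>, of \<theta>] dens_nonneg[OF order_refl \<open>0 \<le> c\<close>, of \<theta>]
      by (auto intro!: AE_I2 order_trans[OF _ abs_ge_self])
  qed (use meas in \<open>auto simp: set_borel_measurable_def\<close>)
  have g_cont: "isCont ?g x" if "x \<in> I0" for x
  proof -
    have sin_nz: "sin x \<noteq> 0" if "x \<in> I0" for x
      using that sin_gt_zero[of x] by (auto simp: I0_def)
    have "continuous_on UNIV trunc_sin"
      unfolding trunc_sin_def by (intro continuous_intros)
    then have "continuous_on I0 (\<lambda>s. trunc_sin (\<theta> s) * (cos s / sin s))"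
      using sin_nz by (intro continuous_intros continuous_on_compose2[of UNIV trunc_sin, OF _ cont]) auto
    then have "continuous_on I0 ?g"
      by (rule continuous_on_eq) (auto simp: src_def cot_def)
    then show ?thesis
      using that by (auto simp: continuous_on_eq_continuous_at I0_def)
  qed
  have G_deriv: "(G has_real_derivative ?g x) (at x)" if x: "0 < x" "x < \<sigma>" for x
  proof -
    have "x \<in> I0"
      using x \<sigma> by (auto simp: I0_def)
    have "((\<lambda>u. integral {0..u} ?g) has_vector_derivative ?g x) (at x within {0..\<sigma>})"
      using x g_int g_cont[OF \<open>x \<in> I0\<close>]
      by (intro integral_has_vector_derivative_continuous_at[where S="{}", simplified])
        (auto intro: continuous_at_imp_continuous_within)
    then have "(G has_real_derivative ?g x) (at x within {0..\<sigma>})"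
      by (simp add: G_def[abs_def] has_real_derivative_iff_has_vector_derivative)
    then show ?thesis
      using x at_within_Icc_at[of 0 x \<sigma>] by simp
  qed
  have "(?\<zeta> has_integral ln (1 + c * G \<sigma>) - ln (1 + c * G 0)) {0..\<sigma>}"
  proof (rule fundamental_theorem_of_calculus_interior)
    have "continuous_on {0..\<sigma>} G"
      unfolding G_def[abs_def] by (rule indefinite_integral_continuous_1[OF g_int])
    then show "continuous_on {0..\<sigma>} (\<lambda>x. ln (1 + c * G x))"
      using pos by (intro continuous_intros) (auto simp: less_imp_neq[symmetric])
    fix x assume "x \<in> {0<..<\<sigma>}"
    then have "((\<lambda>x. ln (1 + c * G x)) has_real_derivative ?\<zeta> x) (at x)"
      using pos[of x] by (auto intro!: derivative_eq_intros G_deriv simp: dens_def G_eq)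
    then show "((\<lambda>x. ln (1 + c * G x)) has_vector_derivative ?\<zeta> x) (at x)"
      by (simp add: has_real_derivative_iff_has_vector_derivative)
  qed (use \<sigma> in \<open>auto simp: I0_def\<close>)
  then have "integral {0..\<sigma>} ?\<zeta> = ln (1 + c * G \<sigma>)"
    by (simp add: G_def integral_unique)
  then have "(LBINT s:{0<..<\<sigma>}. ?\<zeta> s) = ln (1 + c * G \<sigma>)"
    using set_integral_open_eq_integral(1)[OF \<zeta>_int] by simp
  then show ?thesis
    using pos[of \<sigma>] by (simp add: G_eq)
qed

text \<open>This identifies the finite sine sum as an integral operator with kernel
  \<open>K_part\<close>, the form in which it can converge to \<open>H\<close>.\<close>

lemma sin_poly_sine_coeff_eq:
  assumes "f \<in> borel_measurable borel" "\<And>s. s \<in> I0 \<Longrightarrow> \<bar>f s\<bar> \<le> B"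
  shows "sin_poly N (\<lambda>m. r ^ Suc m * sine_coeff f m) \<sigma> = 1 / pi * (LBINT s:I0. K_part r N s \<sigma> * f s)"
proof -
  have "(LBINT s:I0. K_part r N s \<sigma> * f s) = (LBINT s:I0. \<Sum>m<N.
      (2 * r ^ Suc m / (real m + 1) * sin (2 * (real m + 1) * \<sigma>)) * (f s * sin (2 * (real m + 1) * s)))"
    by (simp add: K_part_def sum_distrib_left sum_distrib_right mult_ac)
  also have "\<dots> = (\<Sum>m<N. (2 * r ^ Suc m / (real m + 1) * sin (2 * (real m + 1) * \<sigma>)) *
       (LBINT s:I0. f s * sin (2 * (real m + 1) * s)))"
    using bounded_sin_set_integrable[OF assms] by (subst set_integral_sum) auto
  finally have eq: "(LBINT s:I0. K_part r N s \<sigma> * f s) =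
     (\<Sum>m<N. (2 * r ^ Suc m / (real m + 1) * sin (2 * (real m + 1) * \<sigma>)) * (LBINT s:I0. f s * sin (2 * (real m + 1) * s)))" .
  have "r ^ Suc m * (4 / pi * x) / (2 * (real m + 1)) * y = 1 / pi * ((2 * r ^ Suc m / (real m + 1) * y) * x)" for m x y
    by (simp add: divide_simps)
  then show ?thesis
    unfolding eq sin_poly_def sine_coeff_def sum_distrib_left by (intro sum.cong) auto
qed

text \<open>Up to pi/4 the first bound gives at most \<open>pi/4 + 3*pi/4\<close>. Beyond it, with
  \<open>t = sqrt (pi/2 - \<sigma>)\<close> and \<open>p = sqrt pi / 2\<close>, the claim reduces to
  \<open>(p - t) * (2 * p - t) \<ge> 0\<close>. Both estimates are sharp at pi/4.\<close>

lemma solution_angle_le_pi: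
  fixes \<sigma> u :: real
  assumes "\<sigma> \<in> I0" and u: "u \<le> sqrt \<sigma> * (9 * sqrt pi / 2)" "u \<le> sqrt (pi / 2 - \<sigma>) * (9 * sqrt pi / 2)"
  shows "\<sigma> + u / 3 \<le> pi"
proof (cases "\<sigma> \<le> pi / 4")
  case True
  have "sqrt \<sigma> \<le> sqrt (pi / 4)"
    using True by simp
  then have "sqrt \<sigma> * (9 * sqrt pi / 2) \<le> sqrt pi / 2 * (9 * sqrt pi / 2)"
    by (intro mult_right_mono) (auto simp: real_sqrt_divide)
  also have "\<dots> = 9 * pi / 4"
    by simp
  finally show ?thesis
    using True u by linarith
next
  case False
  define t where "t = sqrt (pi / 2 - \<sigma>)"
  define p where "p = sqrt pi / 2"
  have t2: "t\<^sup>2 = pi / 2 - \<sigma>" "0 \<le> t"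
    using assms(1) by (auto simp: t_def I0_def)
  have p2: "p\<^sup>2 = pi / 4" "0 \<le> p"
    by (auto simp: p_def power_divide)
  have "t \<le> p"
    using False unfolding t_def p_def by (intro real_le_lsqrt) (auto simp: power_divide)
  have "0 \<le> (p - t) * (2 * p - t)"
    using \<open>t \<le> p\<close> p2 t2 by (intro mult_nonneg_nonneg) auto
  then have "3 * p * t \<le> 2 * p\<^sup>2 + t\<^sup>2"
    by (simp add: power2_eq_square algebra_simps)
  moreover have "u \<le> t * (9 * p)"
    using u(2) by (simp add: t_def p_def)
  ultimately show ?thesis
    using t2(1) p2(1) by (simp add: algebra_simps)
qed


text \<open>The bound on the angle cancels half of the singularity of the cotangent. The term
  \<open>2 * s\<close> instead of \<open>s\<close> leaves room for the approximation error, which is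
  below \<open>s\<close> on the cut-off set.\<close>

lemma src_le_inverse_sqrt:
  assumes "s \<in> I0" and \<theta>: "\<bar>\<theta> s\<bar> \<le> 2 * s + sqrt s * (R / 3)" and "0 \<le> R"
  shows "src A \<theta> s \<le> (4 + R / 3) * (1 / sqrt s)"
proof -
  have s: "0 < s" "s \<le> pi / 2" "s < 2"
    using assms(1) pi_half_less_two by (auto simp: I0_def)
  have "trunc_sin (\<theta> s) \<le> \<bar>\<theta> s\<bar>"
    using trunc_sin_Lipschitz[of "\<theta> s" 0] by (simp add: trunc_sin_def)
  with \<theta> have "trunc_sin (\<theta> s) * cot s \<le> (2 * s + sqrt s * (R / 3)) * (1 / s)"
    using s \<open>0 \<le> R\<close> by (intro mult_mono cot_le_inverse cot_nonneg_pi_half) auto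
  also have "\<dots> = 2 * sqrt s * (1 / sqrt s) + R / 3 * (1 / sqrt s)"
  proof -
    have "sqrt s / s = 1 / sqrt s"
      using s by (simp add: real_div_sqrt field_simps)
    moreover have "(2 * s + sqrt s * (R / 3)) * (1 / s) = 2 * (s / s) + R / 3 * (sqrt s / s)"
      by (simp add: add_divide_distrib)
    ultimately show ?thesis
      using s by simp
  qed
  also have "\<dots> \<le> 4 * (1 / sqrt s) + R / 3 * (1 / sqrt s)"
  proof -
    have "sqrt s \<le> 2"
      using s by (intro real_le_lsqrt) auto
    then show ?thesis
      using s by (intro add_right_mono mult_right_mono) auto
  qed
  finally have "trunc_sin (\<theta> s) * cot s \<le> (4 + R / 3) * (1 / sqrt s)"
    by (simp add: distrib_right add_divide_distrib)
  moreover have "0 \<le> (4 + R / 3) * (1 / sqrt s)"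
    using s \<open>0 \<le> R\<close> by simp
  ultimately show ?thesis
    by (simp add: src_def indicator_def)
qed

text \<open>Convergence of the sine sums gives convergence of angles, then of sources, of their
  integrals and of densities. The majorant \<open>w\<close> controls the integrals, Fatou the norm,
  and uniqueness of limits identifies \<open>g\<close> with the image of the limit under
  \<open>H\<close>.\<close>

lemma limit_of_approximants:
  fixes \<delta> r :: "nat \<Rightarrow> real" and \<theta> \<zeta> :: "nat \<Rightarrow> real \<Rightarrow> real" and \<beta> :: "nat \<Rightarrow> nat \<Rightarrow> real"
  assumes \<delta>: "\<And>k. 0 < \<delta> k" "\<delta> \<longlonglongrightarrow> 0" and r: "\<And>k. 0 < r k" "\<And>k. r k < 1" "r \<longlonglongrightarrow> 1"
    and N: "\<And>k. 2 * r k ^ Suc (N k) / (1 - r k) \<le> \<delta> k" "\<And>k. \<delta> k \<le> 1"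
    and "0 \<le> c" and R: "0 \<le> R"
    and \<theta>_meas: "\<And>k. \<theta> k \<in> borel_measurable borel"
    and \<zeta>: "\<And>k. \<zeta> k = dens c {\<delta> k..<pi/2} (\<theta> k)"
    and \<beta>: "\<And>k. \<beta> k = (\<lambda>m. r k ^ Suc m * sine_coeff (\<zeta> k) m)"
    and close: "\<And>k \<sigma>. \<bar>\<theta> k \<sigma> - (\<sigma> + 1/3 * sin_poly (N k) (\<beta> k) \<sigma>)\<bar> \<le> \<delta> k / 20"
    and norm\<zeta>: "\<And>k. sqrt (LBINT s:I0. (\<zeta> k s)\<^sup>2) \<le> R"
    and u_bound: "\<And>k \<sigma>. \<sigma> \<in> I0 \<Longrightarrow> \<bar>sin_poly (N k) (\<beta> k) \<sigma>\<bar> \<le> sqrt \<sigma> * R"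
    and conv: "\<And>\<sigma>. \<sigma> \<in> I0 \<Longrightarrow> (\<lambda>k. sin_poly (N k) (\<beta> k) \<sigma>) \<longlonglongrightarrow> g \<sigma>"
    and cont: "continuous_on I0 g"
  obtains \<zeta>\<^sub>0 where "\<zeta>\<^sub>0 \<in> L2" "L2norm \<zeta>\<^sub>0 \<le> R" "\<And>\<sigma>. 0 \<le> \<zeta>\<^sub>0 \<sigma>"
    "\<And>\<sigma>. \<sigma> \<in> I0 \<Longrightarrow> H \<zeta>\<^sub>0 \<sigma> = g \<sigma>"
    "\<And>\<sigma>. \<sigma> \<in> I0 \<Longrightarrow> \<zeta>\<^sub>0 \<sigma> = c * (trunc_sin (\<sigma> + 1/3 * g \<sigma>) * cot \<sigma>) / exp (LBINT s:{0<..<\<sigma>}. \<zeta>\<^sub>0 s)"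
proof -
  \<comment> \<open>The indicator extends the angle to a Borel function on the line, as
    \<open>g\<close> is controlled only on \<open>I0\<close>.\<close>
  define \<theta>0 where "\<theta>0 \<sigma> = indicator I0 \<sigma> * (\<sigma> + 1/3 * g \<sigma>)" for \<sigma>
  define z where "z = dens c I0 \<theta>0"
  define w where "w s = (4 + R / 3) * (indicator I0 s * (1 / sqrt s))" for s
  have g_cont: "continuous_on I0 (\<lambda>\<sigma>. \<sigma> + 1/3 * g \<sigma>)"
    using cont by (intro continuous_intros)
  then have \<theta>0_cont: "continuous_on I0 \<theta>0"
    by (rule continuous_on_eq) (simp add: \<theta>0_def)
  have \<theta>0_meas [measurable]: "\<theta>0 \<in> borel_measurable borel"
    using borel_measurable_continuous_on_indicator[OF I0_measurable g_cont] by (simp add: \<theta>0_def[abs_def])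
  have \<theta>_lim: "(\<lambda>k. \<theta> k s) \<longlonglongrightarrow> \<theta>0 s" if "s \<in> I0" for s
  proof -
    have "(\<lambda>k. \<delta> k / 20) \<longlonglongrightarrow> 0"
      using tendsto_divide[OF \<delta>(2) tendsto_const[of 20]] by simp
    then have "(\<lambda>k. \<theta> k s - (s + 1/3 * sin_poly (N k) (\<beta> k) s)) \<longlonglongrightarrow> 0"
      by (rule Lim_null_comparison[rotated]) (use close in auto)
    moreover have "(\<lambda>k. s + 1/3 * sin_poly (N k) (\<beta> k) s) \<longlonglongrightarrow> s + 1/3 * g s"
      using conv[OF that] by (intro tendsto_intros)
    ultimately have "(\<lambda>k. (\<theta> k s - (s + 1/3 * sin_poly (N k) (\<beta> k) s)) + (s + 1/3 * sin_poly (N k) (\<beta> k) s)) \<longlonglongrightarrow> 0 + (s + 1/3 * g s)"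
      by (rule tendsto_add)
    then show ?thesis
      using that by (simp add: \<theta>0_def)
  qed
  have src_lim: "(\<lambda>k. src {\<delta> k..<pi/2} (\<theta> k) s) \<longlonglongrightarrow> src I0 \<theta>0 s" for s
  proof (cases "s \<in> I0")
    case True
    \<comment> \<open>Each fixed point of \<open>I0\<close> eventually leaves the region removed by
      the cut-off.\<close>
    then have "eventually (\<lambda>k. \<delta> k < s) sequentially"
      by (intro order_tendstoD(2)[OF \<delta>(2)]) (auto simp: I0_def)
    then have "eventually (\<lambda>k. trunc_sin (\<theta> k s) * cot s = src {\<delta> k..<pi/2} (\<theta> k) s) sequentially"
      by eventually_elim (use True in \<open>auto simp: src_def I0_def\<close>)
    moreover have "(\<lambda>k. trunc_sin (\<theta> k s) * cot s) \<longlonglongrightarrow> trunc_sin (\<theta>0 s) * cot s"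
      by (intro tendsto_intros trunc_sin_tendsto \<theta>_lim True)
    ultimately show ?thesis
      using True by (auto simp: src_def[of I0] elim: Lim_transform_eventually[rotated])
  next
    case False
    then have "src {\<delta> k..<pi/2} (\<theta> k) s = 0" for k
      using cutoff_subset[OF \<delta>(1)[of k]] by (auto simp: src_def indicator_def)
    then show ?thesis
      using False by (simp add: src_def[of I0])
  qed
  have src_w: "src {\<delta> k..<pi/2} (\<theta> k) s \<le> w s" for k s
  proof (cases "s \<in> {\<delta> k..<pi/2}")
    case True
    then have s: "s \<in> I0" "\<delta> k \<le> s"
      using cutoff_subset[OF \<delta>(1)[of k]] by auto
    have "\<bar>\<theta> k s\<bar> \<le> s + sqrt s * R / 3 + \<delta> k / 20"
    proof -
      have "0 < s"
        using s(1) by (simp add: I0_def)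
      then show ?thesis
        using close[of k s] u_bound[OF s(1), of k] by linarith
    qed
    also have "\<dots> \<le> 2 * s + sqrt s * (R / 3)"
      using s \<delta>(1)[of k] by simp
    finally show ?thesis
      using src_le_inverse_sqrt[OF s(1) _ R, of "\<theta> k"] s by (simp add: w_def)
  next
    case False
    then have "src {\<delta> k..<pi/2} (\<theta> k) s = 0"
      by (simp add: src_def)
    moreover have "0 \<le> w s"
      using R by (auto simp: w_def indicator_def I0_def)
    ultimately show ?thesis
      by simp
  qed
  have src_nonneg': "0 \<le> src {\<delta> k..<pi/2} (\<theta> k) s" for k s
    by (intro src_nonneg cutoff_subset \<delta>)
  have w_int: "integrable lborel w"
    unfolding w_def using inverse_sqrt_I0_integrable
    by (intro integrable_mult_right) (auto simp: set_integrable_def)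
  have [measurable]: "w \<in> borel_measurable borel"
    using borel_measurable_integrable[OF w_int] by simp
  have src_meas [measurable]: "src {\<delta> k..<pi/2} (\<theta> k) \<in> borel_measurable borel" for k
    by (intro src_measurable \<theta>_meas) auto
  have src0_int: "integrable lborel (src I0 \<theta>0)"
    by (rule integrable_dominated_convergence[where s="\<lambda>k. src {\<delta> k..<pi/2} (\<theta> k)" and w=w])
      (use w_int src_lim src_w src_nonneg' in \<open>auto intro!: AE_I2\<close>)
  have G_lim: "(\<lambda>k. LBINT s:{0<..<\<sigma>}. src {\<delta> k..<pi/2} (\<theta> k) s) \<longlonglongrightarrow> (LBINT s:{0<..<\<sigma>}. src I0 \<theta>0 s)" for \<sigma>
    unfolding set_lebesgue_integral_def
  proof (rule integral_dominated_convergence[where w=w])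
    show "AE s in lborel. (\<lambda>k. indicat_real {0<..<\<sigma>} s *\<^sub>R src {\<delta> k..<pi/2} (\<theta> k) s) \<longlonglongrightarrow> indicat_real {0<..<\<sigma>} s *\<^sub>R src I0 \<theta>0 s"
      by (intro AE_I2 tendsto_intros src_lim)
    show "AE s in lborel. norm (indicat_real {0<..<\<sigma>} s *\<^sub>R src {\<delta> k..<pi/2} (\<theta> k) s) \<le> w s" for k
      using src_w[of k] src_nonneg'[of k] by (auto simp: indicator_def intro!: AE_I2 intro: order_trans)
  qed (use w_int in auto)
  have \<zeta>_lim: "(\<lambda>k. \<zeta> k s) \<longlonglongrightarrow> z s" for s
  proof -
    have "0 \<le> c * (LBINT s:{0<..<s}. src I0 \<theta>0 s)"
      using \<open>0 \<le> c\<close> by (intro mult_nonneg_nonneg src_integral_nonneg) auto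
    then show ?thesis
      unfolding \<zeta> z_def dens_def by (intro tendsto_intros src_lim G_lim) auto
  qed
  have \<zeta>_nonneg: "0 \<le> \<zeta> k s" for k s
    unfolding \<zeta> by (intro dens_nonneg cutoff_subset \<delta> \<open>0 \<le> c\<close>)
  have z_nonneg: "0 \<le> z s" for s
    unfolding z_def by (intro dens_nonneg \<open>0 \<le> c\<close>) auto
  have \<zeta>_w: "\<zeta> k s \<le> c * w s" for k s
  proof -
    have "\<zeta> k s \<le> c * src {\<delta> k..<pi/2} (\<theta> k) s"
      unfolding \<zeta> by (intro dens_le_src cutoff_subset \<delta> \<open>0 \<le> c\<close>)
    also have "\<dots> \<le> c * w s"
      using src_w \<open>0 \<le> c\<close> by (intro mult_left_mono)
    finally show ?thesis .
  qed
  have \<zeta>_meas [measurable]: "\<zeta> k \<in> borel_measurable borel" for k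
    unfolding \<zeta> by (intro dens_cutoff_measurable \<delta> \<theta>_meas)
  have z_meas [measurable]: "z \<in> borel_measurable borel"
    unfolding z_def by (intro dens_measurable src0_int) auto
  have \<zeta>_bound: "\<bar>\<zeta> k s\<bar> \<le> c / \<delta> k" for k s
    unfolding \<zeta> by (intro dens_cutoff_bound \<delta> \<open>0 \<le> c\<close>)
  have L2: "z \<in> L2" "L2norm z \<le> R"
  proof -
    \<comment> \<open>Fatou's lemma for non-negative integrals yields square integrability of
      \<open>z\<close> and its norm bound at once.\<close>
    have "(\<integral>\<^sup>+ s. ennreal (indicator I0 s * (\<zeta> k s)\<^sup>2) \<partial>lborel) \<le> ennreal (R\<^sup>2)" for k
    proof -
      have int: "set_integrable lborel I0 (\<lambda>s. (\<zeta> k s)\<^sup>2)"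
        by (rule set_integrable_bounded_lborel[where B="(c / \<delta> k)\<^sup>2"])
          (use power_mono[OF \<zeta>_bound[of k], of _ 2] in auto)
      then have "(\<integral>\<^sup>+ s. ennreal (indicator I0 s * (\<zeta> k s)\<^sup>2) \<partial>lborel) = ennreal (LBINT s:I0. (\<zeta> k s)\<^sup>2)"
        unfolding set_integrable_def set_lebesgue_integral_def
        by (subst nn_integral_eq_integral) auto
      also have "(LBINT s:I0. (\<zeta> k s)\<^sup>2) \<le> R\<^sup>2"
        using norm\<zeta>[of k] R by (metis sqrt_le_D)
      finally show ?thesis
        by (simp add: ennreal_leI)
    qed
    moreover have "(\<lambda>k. ennreal (indicator I0 s * (\<zeta> k s)\<^sup>2)) \<longlonglongrightarrow> ennreal (indicator I0 s * (z s)\<^sup>2)" for s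
      by (intro tendsto_intros \<zeta>_lim)
    then have "(\<integral>\<^sup>+ s. ennreal (indicator I0 s * (z s)\<^sup>2) \<partial>lborel) =
        (\<integral>\<^sup>+ s. liminf (\<lambda>k. ennreal (indicator I0 s * (\<zeta> k s)\<^sup>2)) \<partial>lborel)"
      by (intro nn_integral_cong) (metis lim_imp_Liminf trivial_limit_sequentially)
    moreover have "(\<integral>\<^sup>+ s. liminf (\<lambda>k. ennreal (indicator I0 s * (\<zeta> k s)\<^sup>2)) \<partial>lborel) \<le>
        liminf (\<lambda>k. \<integral>\<^sup>+ s. ennreal (indicator I0 s * (\<zeta> k s)\<^sup>2) \<partial>lborel)"
      by (intro nn_integral_liminf) measurable
    moreover have "liminf (\<lambda>k. \<integral>\<^sup>+ s. ennreal (indicator I0 s * (\<zeta> k s)\<^sup>2) \<partial>lborel) \<le> liminf (\<lambda>k. ennreal (R\<^sup>2))"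
      using calculation(1) by (intro Liminf_mono) auto
    ultimately have le: "(\<integral>\<^sup>+ s. ennreal (indicator I0 s * (z s)\<^sup>2) \<partial>lborel) \<le> ennreal (R\<^sup>2)"
      by (simp add: Liminf_const)
    have int: "integrable lborel (\<lambda>s. indicator I0 s * (z s)\<^sup>2)"
      using le by (intro integrableI_nonneg) (auto simp: order_le_less_trans)
    then have "ennreal (LBINT s. indicator I0 s * (z s)\<^sup>2) \<le> ennreal (R\<^sup>2)"
      using le by (subst nn_integral_eq_integral[symmetric]) auto
    then have "(LBINT s. indicator I0 s * (z s)\<^sup>2) \<le> R\<^sup>2"
      by (simp add: ennreal_le_iff)
    then have "sqrt (LBINT s. indicator I0 s * (z s)\<^sup>2) \<le> R"
      using R by (simp add: real_le_lsqrt)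
    then show "z \<in> L2" "L2norm z \<le> R"
      using int by (auto simp: L2_def L2norm_def set_integrable_def set_lebesgue_integral_def)
  qed
  have Hz: "H z \<sigma> = g \<sigma>" if \<sigma>: "\<sigma> \<in> I0" for \<sigma>
  proof -
    \<comment> \<open>The majorant comes from
      \<open>|K_part| \<le> K_abel + \<delta> k \<le> K + 1\<close> off the diagonal and from
      \<open>\<zeta> k \<le> c * w\<close>; the product is integrable because
      \<open>K / sqrt s\<close> is.\<close>
    have "(\<lambda>k. LBINT s:I0. K_part (r k) (N k) s \<sigma> * \<zeta> k s) \<longlonglongrightarrow> (LBINT s:I0. K s \<sigma> * z s)"
      unfolding set_lebesgue_integral_def
    proof (rule integral_dominated_convergence[where w="\<lambda>s. indicator I0 s * ((K s \<sigma> + 1) * (c * w s))"])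
      have eq: "indicator I0 s * ((K s \<sigma> + 1) * (c * w s)) =
          c * (4 + R / 3) * (indicator I0 s *\<^sub>R (K s \<sigma> * (1 / sqrt s)) + indicator I0 s *\<^sub>R (1 / sqrt s))" for s
        by (simp add: w_def indicator_def algebra_simps add_divide_distrib)
      show "integrable lborel (\<lambda>s. indicator I0 s * ((K s \<sigma> + 1) * (c * w s)))"
        unfolding eq using K_inverse_sqrt_integrable[OF \<sigma>] inverse_sqrt_I0_integrable
        by (auto simp: set_integrable_def simp del: real_scaleR_def)
      have err: "\<bar>K_abel (r k) s \<sigma> - K_part (r k) (N k) s \<sigma>\<bar> \<le> \<delta> k" for k s
        using K_part_error[of "r k" s \<sigma> "N k"] r(1,2)[of k] N(1)[of k] by simp
      have ne: "AE s in lborel. s \<noteq> \<sigma>"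
        by (rule AE_lborel_singleton)
      show "AE s in lborel. (\<lambda>k. indicator I0 s *\<^sub>R (K_part (r k) (N k) s \<sigma> * \<zeta> k s)) \<longlonglongrightarrow> indicator I0 s *\<^sub>R (K s \<sigma> * z s)"
        using ne
      proof eventually_elim
        fix s assume "s \<noteq> \<sigma>"
        show "(\<lambda>k. indicator I0 s *\<^sub>R (K_part (r k) (N k) s \<sigma> * \<zeta> k s)) \<longlonglongrightarrow> indicator I0 s *\<^sub>R (K s \<sigma> * z s)"
        proof (cases "s \<in> I0")
          case True
          have "(\<lambda>k. K_abel (r k) s \<sigma> - K_part (r k) (N k) s \<sigma>) \<longlonglongrightarrow> 0"
            by (rule Lim_null_comparison[OF _ \<delta>(2)]) (use err in auto)
          from tendsto_diff[OF K_abel_tendsto[OF True \<sigma> \<open>s \<noteq> \<sigma>\<close> r(3)] this]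
          have "(\<lambda>k. K_part (r k) (N k) s \<sigma>) \<longlonglongrightarrow> K s \<sigma>"
            by simp
          then show ?thesis
            by (intro tendsto_intros \<zeta>_lim)
        qed simp
      qed
      show "AE s in lborel. norm (indicator I0 s *\<^sub>R (K_part (r k) (N k) s \<sigma> * \<zeta> k s)) \<le>
          indicator I0 s * ((K s \<sigma> + 1) * (c * w s))" for k
        using ne
      proof eventually_elim
        fix s assume "s \<noteq> \<sigma>"
        show "norm (indicator I0 s *\<^sub>R (K_part (r k) (N k) s \<sigma> * \<zeta> k s)) \<le>
          indicator I0 s * ((K s \<sigma> + 1) * (c * w s))"
        proof (cases "s \<in> I0")
          case True
          have "\<bar>K_part (r k) (N k) s \<sigma>\<bar> \<le> K s \<sigma> + 1"
            using err[of k s] K_abel_bounds[OF True \<sigma> \<open>s \<noteq> \<sigma>\<close> r(1,2)[of k]] N(2)[of k] by linarith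
          then have "\<bar>K_part (r k) (N k) s \<sigma>\<bar> * \<bar>\<zeta> k s\<bar> \<le> (K s \<sigma> + 1) * (c * w s)"
            using \<zeta>_nonneg[of k s] \<zeta>_w[of k s] K_nonneg[OF True \<sigma>] by (intro mult_mono) auto
          then show ?thesis
            using True by (simp add: abs_mult)
        qed simp
      qed
    qed (auto simp: K_part_def)
    then have "(\<lambda>k. 1 / pi * (LBINT s:I0. K_part (r k) (N k) s \<sigma> * \<zeta> k s)) \<longlonglongrightarrow> 1 / pi * (LBINT s:I0. K s \<sigma> * z s)"
      by (intro tendsto_intros)
    moreover have "1 / pi * (LBINT s:I0. K_part (r k) (N k) s \<sigma> * \<zeta> k s) = sin_poly (N k) (\<beta> k) \<sigma>" for k
      unfolding \<beta> by (rule sin_poly_sine_coeff_eq[OF \<zeta>_meas \<zeta>_bound, symmetric])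
    ultimately have "(\<lambda>k. sin_poly (N k) (\<beta> k) \<sigma>) \<longlonglongrightarrow> H z \<sigma>"
      by (simp add: H_def)
    then show ?thesis
      using conv[OF \<sigma>] LIMSEQ_unique by blast
  qed
  show thesis
  proof (rule that[OF L2 z_nonneg Hz])
    fix \<sigma> assume \<sigma>: "\<sigma> \<in> I0"
    have "exp (LBINT s:{0<..<\<sigma>}. z s) = 1 + c * (LBINT s:{0<..<\<sigma>}. src I0 \<theta>0 s)"
      unfolding z_def by (rule exp_integral_dens[OF src0_int \<theta>0_meas \<theta>0_cont \<open>0 \<le> c\<close> \<sigma>])
    then show "z \<sigma> = c * (trunc_sin (\<sigma> + 1/3 * g \<sigma>) * cot \<sigma>) / exp (LBINT s:{0<..<\<sigma>}. z s)"
      using \<sigma> by (simp add: z_def dens_def src_def[of I0 \<theta>0 \<sigma>] \<theta>0_def)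
  qed
qed


section \<open>Choice of parameters, compactness and removal of the truncation\<close>

theorem theorem3p7:
  fixes \<alpha> :: real
  assumes "\<alpha> \<ge> (2 / pi) * (1 + 1 / (3 * sqrt pi))"
  shows "\<exists>\<zeta> \<in> L2.
           (AE \<sigma> in lborel. \<sigma> \<in> I0 \<longrightarrow> \<zeta> \<sigma> \<ge> 0) \<and>
           (AE \<sigma> in lborel. \<sigma> \<in> I0 \<longrightarrow> \<zeta> \<sigma> = Phi \<alpha> \<zeta> \<sigma>) \<and>
           (AE \<sigma> in lborel. \<sigma> \<in> I0 \<longrightarrow> 0 \<le> \<sigma> + (1/3) * H \<zeta> \<sigma> \<and> \<sigma> + (1/3) * H \<zeta> \<sigma> \<le> pi) \<and>
           L2norm \<zeta> \<le> 9 * sqrt pi / 2"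
proof -
  define c where "c = 3 / (\<alpha> * pi)"
  define R where "R = 9 * sqrt pi / 2"
  have R: "0 \<le> R"
    by (simp add: R_def)
  have "0 < (2 / pi) * (1 + 1 / (3 * sqrt pi))"
    by (intro mult_pos_pos add_pos_pos divide_pos_pos) auto
  with assms have \<alpha>: "0 < \<alpha>"
    by linarith
  then have c0: "0 \<le> c"
    by (simp add: c_def)
  have c: "c * (1 + 3 * sqrt pi) \<le> 9 * sqrt pi / 2"
  proof -
    \<comment> \<open>Multiplied by \<open>3 * pi * sqrt pi\<close>, the threshold for \<alpha>
      becomes exactly the condition on \<open>c\<close> used in the a priori bound.\<close>
    have "(2 / pi) * (1 + 1 / (3 * sqrt pi)) * (pi * (3 * sqrt pi)) \<le> \<alpha> * (pi * (3 * sqrt pi))"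
      using assms by (intro mult_right_mono) auto
    moreover have "(2 / pi) * (1 + 1 / (3 * sqrt pi)) * (pi * (3 * sqrt pi)) = 2 * (1 + 3 * sqrt pi)"
      by (simp add: divide_simps)
    ultimately have "2 * (1 + 3 * sqrt pi) \<le> \<alpha> * pi * (3 * sqrt pi)"
      by (simp only: mult.assoc)
    then have "3 * (2 * (1 + 3 * sqrt pi)) / (\<alpha> * pi) \<le> 3 * (\<alpha> * pi * (3 * sqrt pi)) / (\<alpha> * pi)"
      using \<alpha> by (intro divide_right_mono) auto
    then show ?thesis
      using \<alpha> by (simp add: c_def field_simps)
  qed
  \<comment> \<open>The offset 2 gives \<open>\<delta> k \<le> 1/2\<close>, so that
    \<open>r k = 1 - \<delta> k\<close> stays positive and the cut-off lies below pi/2.\<close>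
  define \<delta> where "\<delta> k = 1 / (real k + 2)" for k
  define r where "r k = 1 - \<delta> k" for k
  have \<delta>: "0 < \<delta> k" "\<delta> k \<le> 1 / 2" "\<delta> k < pi / 2" for k
  proof -
    show "0 < \<delta> k" "\<delta> k \<le> 1 / 2"
      by (auto simp: \<delta>_def field_simps)
    then show "\<delta> k < pi / 2"
      using pi_gt3 by linarith
  qed
  have \<delta>_lim: "\<delta> \<longlonglongrightarrow> 0"
    using LIMSEQ_ignore_initial_segment[OF lim_1_over_n[where 'a=real], of 2] by (simp add: \<delta>_def[abs_def] add.commute)
  have r: "0 < r k" "r k < 1" for k
    using \<delta>[of k] by (auto simp: r_def)
  have r_lim: "r \<longlonglongrightarrow> 1"
    unfolding r_def using tendsto_diff[OF tendsto_const[of 1] \<delta>_lim] by simp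
  have "\<exists>n. 2 * r k ^ Suc n / (1 - r k) \<le> \<delta> k" for k
  proof -
    have "0 < \<delta> k * (1 - r k) / 2"
      using \<delta>[of k] r[of k] by simp
    then obtain n where "r k ^ n < \<delta> k * (1 - r k) / 2"
      using real_arch_pow_inv r(2) by blast
    moreover have "r k ^ Suc n \<le> r k ^ n"
      using r[of k] by (intro power_decreasing) auto
    ultimately have "2 * r k ^ Suc n \<le> \<delta> k * (1 - r k)"
      by linarith
    then show ?thesis
      using r[of k] by (intro exI[of _ n]) (simp add: field_simps)
  qed
  then obtain N where N: "\<And>k. 2 * r k ^ Suc (N k) / (1 - r k) \<le> \<delta> k"
    by metis
  define approximant where "approximant k \<theta> \<longleftrightarrow> \<theta> \<in> borel_measurable borel \<and> (\<forall>\<sigma>. \<bar>\<theta> \<sigma> - (\<sigma> + 1/3 *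
      sin_poly (N k) (\<lambda>m. r k ^ Suc m * sine_coeff (dens c {\<delta> k..<pi/2} \<theta>) m) \<sigma>)\<bar> \<le> \<delta> k / 20)" for k \<theta>
  have "\<exists>\<theta>. approximant k \<theta>" for k
  proof (rule approximant_exists[of "\<delta> k" c "\<delta> k / 20" "r k" "N k"])
    fix \<theta> :: "real \<Rightarrow> real"
    assume "\<theta> \<in> borel_measurable borel"
      and "\<And>\<sigma>. \<bar>\<theta> \<sigma> - (\<sigma> + 1/3 *
        sin_poly (N k) (\<lambda>m. r k ^ Suc m * sine_coeff (dens c {\<delta> k..<pi/2} \<theta>) m) \<sigma>)\<bar> \<le> \<delta> k / 20"
    then show "\<exists>\<theta>. approximant k \<theta>"
      unfolding approximant_def by blast
  qed (use \<delta>[of k] r[of k] c0 in auto)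
  then obtain \<theta> where "\<And>k. approximant k (\<theta> k)"
    by metis
  then have \<theta>: "\<theta> k \<in> borel_measurable borel"
    and close: "\<bar>\<theta> k \<sigma> - (\<sigma> + 1/3 *
      sin_poly (N k) (\<lambda>m. r k ^ Suc m * sine_coeff (dens c {\<delta> k..<pi/2} (\<theta> k)) m) \<sigma>)\<bar> \<le> \<delta> k / 20" for k \<sigma>
    by (auto simp: approximant_def)
  define \<zeta> where "\<zeta> k = dens c {\<delta> k..<pi/2} (\<theta> k)" for k
  define \<beta> where "\<beta> k = (\<lambda>m. r k ^ Suc m * sine_coeff (\<zeta> k) m)" for k
  define u where "u k = sin_poly (N k) (\<beta> k)" for k
  have close': "\<bar>\<theta> k \<sigma> - (\<sigma> + 1/3 * sin_poly (N k) (\<beta> k) \<sigma>)\<bar> \<le> \<delta> k / 20" for k \<sigma>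
    unfolding \<beta>_def \<zeta>_def by (rule close)
  have norms: "sqrt (LBINT s:I0. (\<zeta> k s)\<^sup>2) \<le> R" "sqrt (LBINT s:I0. (cos_poly (N k) (\<beta> k) s)\<^sup>2) \<le> R" for k
    unfolding R_def using approximant_bound[OF \<delta>(1,3) c0 _ _ c \<theta> \<zeta>_def \<beta>_def close', of k] r[of k] by auto
  have Hoelder: "\<bar>u k y - u k x\<bar> \<le> sqrt \<bar>y - x\<bar> * R" if "x \<in> {0..pi/2}" "y \<in> {0..pi/2}" for k x y
    unfolding u_def using norms(2)
    by (intro order_trans[OF sin_poly_Hoelder[OF that]] mult_left_mono) auto
  have u_le: "\<bar>u k x\<bar> \<le> sqrt x * R" "\<bar>u k x\<bar> \<le> sqrt (pi/2 - x) * R" if "x \<in> {0..pi/2}" for k x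
    using Hoelder[of 0 x k] Hoelder[of "pi/2" x k] that by (auto simp: u_def)
  obtain g \<kappa> where g: "continuous_on {0..pi/2} g" and \<kappa>: "strict_mono (\<kappa> :: nat \<Rightarrow> nat)"
    and unif: "\<And>e. 0 < e \<Longrightarrow> \<exists>n0. \<forall>n x. n \<ge> n0 \<and> x \<in> {0..pi/2} \<longrightarrow> norm (u (\<kappa> n) x - g x) < e"
  proof (rule Arzela_Ascoli[of "{0..pi/2}" u "sqrt (pi/2) * R"])
    show "norm (u n x) \<le> sqrt (pi / 2) * R" if "x \<in> {0..pi/2}" for n x
    proof -
      have "sqrt x * R \<le> sqrt (pi / 2) * R"
        using that R by (intro mult_right_mono) auto
      then show ?thesis
        using u_le(1)[OF that, of n] by simp
    qed
    show "\<exists>d>0. \<forall>n y. y \<in> {0..pi/2} \<and> norm (x - y) < d \<longrightarrow> norm (u n x - u n y) < e"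
      if "x \<in> {0..pi/2}" "0 < e" for x e
    \<comment> \<open>The modulus of continuity inverts the Hoelder bound of exponent 1/2;
      \<open>R + 1\<close> keeps the denominator positive.\<close>
    proof (intro exI[of _ "(e / (R + 1))\<^sup>2"] conjI allI impI)
      show "0 < (e / (R + 1))\<^sup>2"
        using R \<open>0 < e\<close> by simp
      fix n y assume y: "y \<in> {0..pi/2} \<and> norm (x - y) < (e / (R + 1))\<^sup>2"
      then have "sqrt \<bar>x - y\<bar> < e / (R + 1)"
        using R \<open>0 < e\<close> by (intro real_less_lsqrt) auto
      then have "sqrt \<bar>x - y\<bar> * (R + 1) < e"
        using R by (simp add: field_simps)
      moreover have "sqrt \<bar>x - y\<bar> * R \<le> sqrt \<bar>x - y\<bar> * (R + 1)"
        by (intro mult_left_mono) auto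
      ultimately show "norm (u n x - u n y) < e"
        using Hoelder[of y x n] y that by auto
    qed
  qed auto
  have conv: "(\<lambda>k. u (\<kappa> k) x) \<longlonglongrightarrow> g x" if "x \<in> {0..pi/2}" for x
    using unif that by (intro LIMSEQ_I) blast
  have I0_sub: "\<sigma> \<in> {0..pi/2}" if "\<sigma> \<in> I0" for \<sigma>
    using that by (auto simp: I0_def)
  obtain z where z: "z \<in> L2" "L2norm z \<le> R" "\<And>\<sigma>. 0 \<le> z \<sigma>" "\<And>\<sigma>. \<sigma> \<in> I0 \<Longrightarrow> H z \<sigma> = g \<sigma>"
    "\<And>\<sigma>. \<sigma> \<in> I0 \<Longrightarrow> z \<sigma> = c * (trunc_sin (\<sigma> + 1/3 * g \<sigma>) * cot \<sigma>) / exp (LBINT s:{0<..<\<sigma>}. z s)"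
  proof (rule limit_of_approximants[where \<delta>="\<delta> \<circ> \<kappa>" and r="r \<circ> \<kappa>" and N="N \<circ> \<kappa>" and \<theta>="\<theta> \<circ> \<kappa>" and \<zeta>="\<zeta> \<circ> \<kappa>"
        and \<beta>="\<beta> \<circ> \<kappa>" and c=c and R=R and g=g])
    show "(\<delta> \<circ> \<kappa>) \<longlonglongrightarrow> 0" "(r \<circ> \<kappa>) \<longlonglongrightarrow> 1"
      using \<delta>_lim r_lim \<kappa> by (auto intro: LIMSEQ_subseq_LIMSEQ)
    show "(\<delta> \<circ> \<kappa>) k \<le> 1" for k
      using \<delta>(2)[of "\<kappa> k"] by simp
    show "\<bar>sin_poly ((N \<circ> \<kappa>) k) ((\<beta> \<circ> \<kappa>) k) \<sigma>\<bar> \<le> sqrt \<sigma> * R" if "\<sigma> \<in> I0" for k \<sigma>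
      using u_le(1)[OF I0_sub[OF that], of "\<kappa> k"] by (simp add: u_def)
    show "(\<lambda>k. sin_poly ((N \<circ> \<kappa>) k) ((\<beta> \<circ> \<kappa>) k) \<sigma>) \<longlonglongrightarrow> g \<sigma>" if "\<sigma> \<in> I0" for \<sigma>
      using conv[OF I0_sub[OF that]] by (simp add: u_def)
    show "continuous_on I0 g"
      using g by (rule continuous_on_subset) (auto simp: I0_def)
  qed (use \<delta> r N c0 R \<theta> norms close' in \<open>auto simp: \<zeta>_def \<beta>_def\<close>)
  have angle: "0 \<le> \<sigma> + 1/3 * H z \<sigma>" "\<sigma> + 1/3 * H z \<sigma> \<le> pi" if \<sigma>: "\<sigma> \<in> I0" for \<sigma>
  proof -
    \<comment> \<open>The lower bound rests on the signs of \<open>K\<close> and \<open>z\<close>;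
      the upper bound passes the two endpoint estimates for \<open>u\<close> to the limit
      \<open>g\<close>.\<close>
    have "0 \<le> (LBINT s:I0. K s \<sigma> * z s)"
      unfolding set_lebesgue_integral_def using K_nonneg[OF _ \<sigma>] z(3)
      by (intro integral_nonneg_AE AE_I2) (auto simp: indicator_def)
    then show "0 \<le> \<sigma> + 1/3 * H z \<sigma>"
      using \<sigma> by (auto simp: H_def I0_def intro!: add_nonneg_nonneg)
    have "u (\<kappa> k) \<sigma> \<le> sqrt \<sigma> * R" "u (\<kappa> k) \<sigma> \<le> sqrt (pi/2 - \<sigma>) * R" for k
      using u_le[OF I0_sub[OF \<sigma>], of "\<kappa> k"] by linarith+
    then have "g \<sigma> \<le> sqrt \<sigma> * R" "g \<sigma> \<le> sqrt (pi/2 - \<sigma>) * R"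
      using LIMSEQ_le_const2[OF conv[OF I0_sub[OF \<sigma>]]] by blast+
    then show "\<sigma> + 1/3 * H z \<sigma> \<le> pi"
      using solution_angle_le_pi[OF \<sigma>, of "g \<sigma>"] z(4)[OF \<sigma>] by (simp add: R_def)
  qed
  \<comment> \<open>With the angle in [0, pi] the truncated sine is the sine, so the limit equation
    is the original one.\<close>
  have sol: "z \<sigma> = Phi \<alpha> z \<sigma>" if "\<sigma> \<in> I0" for \<sigma>
    using z(5)[OF that] angle[OF that] z(4)[OF that] by (simp add: Phi_def c_def trunc_sin_eq)
  show ?thesis
    by (intro bexI[of _ z] conjI AE_I2 impI sol angle z(1,3) z(2)[unfolded R_def])
qed

end
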